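(* Let $G$ be a bridgeless cubic graph with oddness $\omega=\omega(G)$, and let $n$ be an integer such that $G$ is cyclically $n$-edge connected. If $n \geq \frac{5}{2}\omega - 1$, then $G$ has a nowhere-zero $5$-flow.
   Context: Graphs may have multiple edges but no loops. An orientation $D$ of a graph $M=(V,E)$ assigns a direction to each edge; for $v\in V$, $D^+(v)$ ($D^-(v)$) is the set of edges whose tail (head) is $v$. For an integer $k\ge 2$, a $k$-flow on $M$ is a pair $(D,\varphi)$ with $\varphi:E\to\{0,1,\dots,k-1\}$ such that $\sum_{e\in D^+(v)}\varphi(e)=\sum_{e\in D^-(v)}\varphi(e)$ for every $v\in V$; it is nowhere-zero if $\varphi(e)\neq 0$ for all $e$. The oddness $\omega(G)$ of a bridgeless cubic graph $G$ is the minimum number of odd cycles in a 2-factor of $G$. A connected graph $G=(V,E)$ containing two disjoint cycles is cyclically $n$-edge connected if there is no edge cut $E'\subset E$ with fewer than $n$ edges such that two components of $G-E'$ contain cycles. *)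

theory Defs
  imports Complex_Main "Graph_Theory.Digraph"
begin

text \<open>
  The digraphs of \<^theory>\<open>Graph_Theory.Digraph\<close> already have arbitrarily many parallel arcs, but every
  arc carries a direction.  An undirected multigraph instead assigns to each edge the set of
  its two end vertices; digraphs are used for orientations.
\<close>

record ('v, 'e) multigraph =
  mverts :: "'v set"
  medges :: "'e set"
  mends :: "'e \<Rightarrow> 'v set"

definition multigraph :: "('v, 'e) multigraph \<Rightarrow> bool" where
  "multigraph G \<longleftrightarrow> finite (mverts G) \<and> finite (medges G) \<and>
     (\<forall>e \<in> medges G. mends G e \<subseteq> mverts G \<and> card (mends G e) = 2)"

definition mdegree :: "('v, 'e) multigraph \<Rightarrow> 'v \<Rightarrow> nat" where
  "mdegree G v = card {e \<in> medges G. v \<in> mends G e}"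

definition regular :: "nat \<Rightarrow> ('v, 'e) multigraph \<Rightarrow> bool" where
  "regular r G \<longleftrightarrow> (\<forall>v \<in> mverts G. mdegree G v = r)"

definition cubic :: "('v, 'e) multigraph \<Rightarrow> bool" where
  "cubic G \<longleftrightarrow> regular 3 G"

text \<open>Subgraphs keep the whole map \<^const>\<open>mends\<close>, also outside their own edges, so that a
  subgraph is determined by its vertices and edges and subgraphs can be counted.\<close>

definition msubgraph :: "('v, 'e) multigraph \<Rightarrow> ('v, 'e) multigraph \<Rightarrow> bool" where
  "msubgraph H G \<longleftrightarrow> multigraph H \<and> mverts H \<subseteq> mverts G \<and> medges H \<subseteq> medges G \<and> mends H = mends G"

definition delete_edges :: "('v, 'e) multigraph \<Rightarrow> 'e set \<Rightarrow> ('v, 'e) multigraph" where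
  "delete_edges G S = G\<lparr>medges := medges G - S\<rparr>"

definition adjacency :: "('v, 'e) multigraph \<Rightarrow> ('v \<times> 'v) set" where
  "adjacency G = {(u, v). \<exists>e \<in> medges G. mends G e = {u, v}}"

definition mconnected :: "('v, 'e) multigraph \<Rightarrow> bool" where
  "mconnected G \<longleftrightarrow> mverts G \<noteq> {} \<and> (\<forall>u \<in> mverts G. \<forall>v \<in> mverts G. (u, v) \<in> (adjacency G)\<^sup>*)"

definition component :: "('v, 'e) multigraph \<Rightarrow> ('v, 'e) multigraph \<Rightarrow> bool" where
  "component G H \<longleftrightarrow> msubgraph H G \<and> mconnected H \<and>
     (\<forall>K. msubgraph K G \<and> mconnected K \<and> msubgraph H K \<longrightarrow> K = H)"

text \<open>A bridge is an edge that separates its two ends.\<close>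

definition bridge :: "('v, 'e) multigraph \<Rightarrow> 'e \<Rightarrow> bool" where
  "bridge G e \<longleftrightarrow> e \<in> medges G \<and>
     (\<exists>u v. mends G e = {u, v} \<and> (u, v) \<notin> (adjacency (delete_edges G {e}))\<^sup>*)"

definition bridgeless :: "('v, 'e) multigraph \<Rightarrow> bool" where
  "bridgeless G \<longleftrightarrow> (\<nexists>e. bridge G e)"

text \<open>A cycle is a connected 2-regular subgraph; two parallel edges form a cycle of length 2.\<close>

definition mcycle :: "('v, 'e) multigraph \<Rightarrow> ('v, 'e) multigraph \<Rightarrow> bool" where
  "mcycle G C \<longleftrightarrow> msubgraph C G \<and> mconnected C \<and> regular 2 C"

definition odd_cycle :: "('v, 'e) multigraph \<Rightarrow> ('v, 'e) multigraph \<Rightarrow> bool" where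
  "odd_cycle G C \<longleftrightarrow> mcycle G C \<and> odd (card (medges C))"

definition two_factor :: "('v, 'e) multigraph \<Rightarrow> ('v, 'e) multigraph \<Rightarrow> bool" where
  "two_factor G F \<longleftrightarrow> msubgraph F G \<and> mverts F = mverts G \<and> regular 2 F"

text \<open>Meaningful only if a 2-factor exists, as it does in every bridgeless cubic graph by
  Petersen's theorem.\<close>

definition oddness :: "('v, 'e) multigraph \<Rightarrow> nat" where
  "oddness G = (LEAST m. \<exists>F. two_factor G F \<and> m = card {C. odd_cycle F C})"

definition edge_cut :: "('v, 'e) multigraph \<Rightarrow> 'e set \<Rightarrow> bool" where
  "edge_cut G S \<longleftrightarrow> S \<subseteq> medges G \<and> \<not> mconnected (delete_edges G S)"

text \<open>Connectedness and the existence of two disjoint cycles are part of the notion.\<close>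

definition cyclically_edge_connected :: "int \<Rightarrow> ('v, 'e) multigraph \<Rightarrow> bool" where
  "cyclically_edge_connected n G \<longleftrightarrow>
     mconnected G \<and>
     (\<exists>C1 C2. mcycle G C1 \<and> mcycle G C2 \<and> mverts C1 \<inter> mverts C2 = {}) \<and>
     (\<nexists>S. edge_cut G S \<and> int (card S) < n \<and>
        (\<exists>H1 H2. component (delete_edges G S) H1 \<and> component (delete_edges G S) H2 \<and> H1 \<noteq> H2 \<and>
           (\<exists>C. mcycle H1 C) \<and> (\<exists>C. mcycle H2 C)))"

definition orientation :: "('v, 'e) multigraph \<Rightarrow> ('v, 'e) pre_digraph \<Rightarrow> bool" where
  "orientation G D \<longleftrightarrow> verts D = mverts G \<and> arcs D = medges G \<and>
     (\<forall>e \<in> medges G. mends G e = {tail D e, head D e})"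

definition k_flow :: "nat \<Rightarrow> ('v, 'e) multigraph \<Rightarrow> ('v, 'e) pre_digraph \<Rightarrow> ('e \<Rightarrow> nat) \<Rightarrow> bool" where
  "k_flow k G D \<phi> \<longleftrightarrow> 2 \<le> k \<and> orientation G D \<and> (\<forall>e \<in> medges G. \<phi> e \<in> {0..k - 1}) \<and>
     (\<forall>v \<in> mverts G. (\<Sum>e \<in> out_arcs D v. \<phi> e) = (\<Sum>e \<in> in_arcs D v. \<phi> e))"

definition nowhere_zero_k_flow ::
    "nat \<Rightarrow> ('v, 'e) multigraph \<Rightarrow> ('v, 'e) pre_digraph \<Rightarrow> ('e \<Rightarrow> nat) \<Rightarrow> bool" where
  "nowhere_zero_k_flow k G D \<phi> \<longleftrightarrow> k_flow k G D \<phi> \<and> (\<forall>e \<in> medges G. \<phi> e \<noteq> 0)"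

end

theory Submission
  imports Defs
begin

text \<open>
  By Petersen's theorem, choose a 2-factor \<open>F\<close> with \<open>\<omega>\<close> odd cycles, with complementary perfect
  matching \<open>M\<close>, and a maximum matching \<open>N\<close> of \<open>F\<close>; it misses exactly one vertex of every odd cycle.
  The graph \<open>M \<union> N\<close> is bipartite; let \<open>s = \<plusminus>1\<close> be its colouring. A cubic graph has a nowhere-zero
  5-flow once \<open>5 |s(X)| \<le> 3 |\<partial>X|\<close> for all \<open>X\<close>. Suppose this fails, and let \<open>\<beta>\<close> be the absolute sum
  of \<open>s\<close> over the missed vertices in \<open>X\<close>. Since \<open>s\<close> sums to zero on every edge of \<open>M\<close> and of \<open>N\<close>,
  \<open>|s(X)| \<le> |\<partial>\<^sub>M X|\<close> and \<open>|s(X)| \<le> |\<partial>\<^sub>F X| + \<beta>\<close>, where \<open>\<beta> \<le> \<omega>/2\<close> because the missed vertices are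
  balanced. If no odd cycle of \<open>F\<close> lies inside \<open>X\<close>, each missed vertex in \<open>X\<close> accounts for two edges
  of \<open>\<partial>\<^sub>F X\<close>, so \<open>2 \<beta> \<le> |\<partial>\<^sub>F X|\<close> and the two bounds add up to \<open>5 |s(X)| \<le> 3 |\<partial>X|\<close>. Hence both \<open>X\<close>
  and its complement contain an odd cycle and \<open>|\<partial>X| \<ge> n\<close>, whereas the two bounds now give
  \<open>|s(X)| \<le> 3\<beta> - 1\<close> and so \<open>|\<partial>X| < 5\<omega>/2 - 5/3 < n\<close>.
\<close>

section \<open>Flows\<close>

definition net :: "'e set \<Rightarrow> ('e \<Rightarrow> 'v) \<Rightarrow> ('e \<Rightarrow> 'v) \<Rightarrow> ('e \<Rightarrow> int) \<Rightarrow> 'v \<Rightarrow> int" where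
  "net E t h y v = (\<Sum>e\<in>E. y e * (of_bool (t e = v) - of_bool (h e = v)))"

text \<open>With the end maps exchanged, as in \<open>cap_out E h t c X\<close>, the same formula
  gives the capacity entering \<open>X\<close>.\<close>

definition cap_out :: "'e set \<Rightarrow> ('e \<Rightarrow> 'v) \<Rightarrow> ('e \<Rightarrow> 'v) \<Rightarrow> ('e \<Rightarrow> int) \<Rightarrow> 'v set \<Rightarrow> int" where
  "cap_out E t h c X = (\<Sum>e\<in>E. c e * of_bool (t e \<in> X \<and> h e \<notin> X))"

lemma net_sum:
  assumes "finite X"
  shows "(\<Sum>v\<in>X. net E t h y v) = (\<Sum>e\<in>E. y e * (of_bool (t e \<in> X) - of_bool (h e \<in> X)))"
proof -
  have 1: "(\<Sum>v\<in>X. of_bool (a = v) :: int) = of_bool (a \<in> X)" for a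
    using assms by (simp add: of_bool_def)
  have "(\<Sum>v\<in>X. net E t h y v) =
      (\<Sum>e\<in>E. \<Sum>v\<in>X. y e * (of_bool (t e = v) - of_bool (h e = v)))"
    unfolding net_def by (rule sum.swap)
  also have "\<dots> = (\<Sum>e\<in>E. y e * (of_bool (t e \<in> X) - of_bool (h e \<in> X)))"
    by (simp only: sum_distrib_left [symmetric] sum_subtractf 1)
  finally show ?thesis .
qed

lemma net_sum_cap_out:
  assumes "finite X"
  shows "(\<Sum>v\<in>X. net E t h y v) = cap_out E t h y X - cap_out E h t y X"
  unfolding net_sum [OF assms] cap_out_def sum_subtractf [symmetric]
  by (rule sum.cong) auto

text \<open>The comparison is edgewise. The edge \<open>f\<close> runs from \<open>X - Y\<close> to
  \<open>Y - X\<close>, so it leaves \<open>X\<close> but neither the intersection nor the union;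
  this gap is the extra term \<open>c f\<close>, which makes uncrossing strict.\<close>

lemma cap_out_submodular:
  assumes "finite E" "\<And>e. e \<in> E \<Longrightarrow> 0 \<le> c e"
    and "f \<in> E" "t f \<in> X - Y" "h f \<in> Y - X"
  shows "cap_out E t h c (X \<inter> Y) + cap_out E t h c (X \<union> Y) + c f
    \<le> cap_out E t h c X + cap_out E t h c Y"
proof -
  have "c f = (\<Sum>e\<in>E. c e * of_bool (e = f))"
    using assms(1,3) by (simp add: of_bool_def if_distrib [of "(*) _"] cong: if_cong)
  then have "cap_out E t h c (X \<inter> Y) + cap_out E t h c (X \<union> Y) + c f =
    (\<Sum>e\<in>E. c e * (of_bool (t e \<in> X \<inter> Y \<and> h e \<notin> X \<inter> Y)
       + of_bool (t e \<in> X \<union> Y \<and> h e \<notin> X \<union> Y) + of_bool (e = f)))"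
    unfolding cap_out_def by (simp add: sum.distrib distrib_left)
  also have "\<dots> \<le> (\<Sum>e\<in>E. c e * (of_bool (t e \<in> X \<and> h e \<notin> X) + of_bool (t e \<in> Y \<and> h e \<notin> Y)))"
    using assms by (intro sum_mono mult_left_mono) auto
  also have "\<dots> = cap_out E t h c X + cap_out E t h c Y"
    unfolding cap_out_def by (simp add: sum.distrib distrib_left)
  finally show ?thesis .
qed

lemma net_fun_upd:
  assumes "finite E" "f \<in> E"
  shows "net E t h (y(f := y f + k)) v = net E t h y v + k * (of_bool (t f = v) - of_bool (h f = v))"
proof -
  have "net E t h (y(f := y f + k)) v =
    (\<Sum>e\<in>E. y e * (of_bool (t e = v) - of_bool (h e = v)) +
      (if e = f then k * (of_bool (t f = v) - of_bool (h f = v)) else 0))"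
    unfolding net_def by (rule sum.cong) (auto simp: algebra_simps)
  then show ?thesis
    using assms by (simp add: sum.distrib net_def)
qed

lemma cap_out_fun_upd:
  assumes "finite E" "f \<in> E"
  shows "cap_out E t h (c(f := c f + k)) X = cap_out E t h c X + k * of_bool (t f \<in> X \<and> h f \<notin> X)"
proof -
  have "cap_out E t h (c(f := c f + k)) X =
    (\<Sum>e\<in>E. c e * of_bool (t e \<in> X \<and> h e \<notin> X) +
      (if e = f then k * of_bool (t f \<in> X \<and> h f \<notin> X) else 0))"
    unfolding cap_out_def by (rule sum.cong) (auto simp: algebra_simps)
  then show ?thesis
    using assms by (simp add: sum.distrib cap_out_def)
qed

text \<open>If the last unit of capacity of an edge \<open>f\<close> cannot be discarded, some tight set is left by
  \<open>f\<close>; if it cannot be used up either, some tight set is entered by \<open>f\<close>. Uncrossing these two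
  tight sets contradicts submodularity.\<close>

lemma feasible_flow:
  fixes b :: "'v \<Rightarrow> int" and c :: "'e \<Rightarrow> int"
  assumes "finite V" "finite E" "\<And>e. e \<in> E \<Longrightarrow> t e \<in> V" "\<And>e. e \<in> E \<Longrightarrow> h e \<in> V"
    and "\<And>e. e \<in> E \<Longrightarrow> 0 \<le> c e" "sum b V = 0"
    and "\<And>X. X \<subseteq> V \<Longrightarrow> sum b X \<le> cap_out E t h c X"
  shows "\<exists>y. (\<forall>e\<in>E. 0 \<le> y e \<and> y e \<le> c e) \<and> (\<forall>v\<in>V. net E t h y v = b v)"
  using assms(5-)
proof (induction "nat (\<Sum>e\<in>E. c e)" arbitrary: c b rule: less_induct)
  case less
  note fin = assms(1,2)
  show ?case
  proof (cases "\<exists>f\<in>E. 0 < c f")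
    case False
    then have c0: "c e = 0" if "e \<in> E" for e
      using less.prems(1) that by force
    have b_le: "sum b X \<le> 0" if "X \<subseteq> V" for X
      using less.prems(3) [OF that] by (simp add: cap_out_def c0)
    have "b v = 0" if "v \<in> V" for v
    proof -
      have "b v + sum b (V - {v}) = 0"
        using less.prems(2) fin(1) that by (simp add: sum.remove)
      then show ?thesis
        using b_le [of "{v}"] b_le [of "V - {v}"] that by simp
    qed
    then show ?thesis
      by (intro exI [of _ "\<lambda>_. 0"]) (simp add: net_def c0)
  next
    case True
    then obtain f where f: "f \<in> E" "0 < c f"
      by blast
    \<comment> \<open>Written as adding \<open>-1\<close> so that \<open>cap_out_fun_upd\<close>
      applies.\<close>
    define c' where "c' = c(f := c f + (-1))"
    have c'_ge: "0 \<le> c' e" if "e \<in> E" for e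
      using less.prems(1) f that by (auto simp: c'_def)
    have "(\<Sum>e\<in>E. c' e) < (\<Sum>e\<in>E. c e)"
      using f fin(2) by (intro sum_strict_mono2 sum_strict_mono_ex1) (auto simp: c'_def)
    moreover have "0 \<le> (\<Sum>e\<in>E. c' e)"
      using c'_ge by (simp add: sum_nonneg)
    ultimately have small: "nat (\<Sum>e\<in>E. c' e) < nat (\<Sum>e\<in>E. c e)"
      by linarith
    have cap': "cap_out E t h c' X = cap_out E t h c X - of_bool (t f \<in> X \<and> h f \<notin> X)" for X
      unfolding c'_def by (subst cap_out_fun_upd [OF fin(2) f(1)]) simp
    show ?thesis
    proof (cases "\<forall>X\<subseteq>V. sum b X \<le> cap_out E t h c' X")
      case True
      then obtain y where y: "\<forall>e\<in>E. 0 \<le> y e \<and> y e \<le> c' e" "\<forall>v\<in>V. net E t h y v = b v"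
        using less.hyps [OF small c'_ge less.prems(2)] by blast
      have "c' e \<le> c e" for e
        by (simp add: c'_def)
      then show ?thesis
        using y order_trans by blast
    next
      case False
      then obtain X where X: "X \<subseteq> V" "cap_out E t h c' X < sum b X"
        by (auto simp: not_le)
      \<comment> \<open>All values are integers, so a violation caused by losing one unit means that
        \<open>f\<close> leaves \<open>X\<close> and that \<open>X\<close> was tight before.\<close>
      then have tX: "t f \<in> X" "h f \<notin> X" and tight: "cap_out E t h c X \<le> sum b X"
        using less.prems(3) [OF X(1)] by (auto simp: cap' of_bool_def split: if_splits)
      \<comment> \<open>One unit is sent along \<open>f\<close> in advance; \<open>b'\<close> is
        what remains to be routed under the capacities \<open>c'\<close>.\<close>
      define b' where "b' = (\<lambda>v. b v - of_bool (t f = v) + of_bool (h f = v))"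
      have b'_sum: "sum b' Y = sum b Y - of_bool (t f \<in> Y) + of_bool (h f \<in> Y)" if "finite Y" for Y
        using that unfolding b'_def
        by (simp add: sum.distrib sum_subtractf of_bool_def)
      have "sum b' V = 0"
        using b'_sum [OF fin(1)] less.prems(2) f(1) assms(3,4) by simp
      \<comment> \<open>Only a set entered by \<open>f\<close> gains demand; for all other sets
        demand and capacity drop by the same amount.\<close>
      moreover have "sum b' Y \<le> cap_out E t h c' Y" if Y: "Y \<subseteq> V" for Y
      proof (cases "t f \<notin> Y \<and> h f \<in> Y")
        case True
        have fY: "finite Y" "finite X"
          using Y X(1) fin(1) finite_subset by auto
        have "cap_out E t h c (X \<inter> Y) + cap_out E t h c (X \<union> Y) + c f
            \<le> cap_out E t h c X + cap_out E t h c Y"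
          using True tX f fin(2) less.prems(1) by (intro cap_out_submodular) auto
        moreover have "sum b (X \<inter> Y) \<le> cap_out E t h c (X \<inter> Y)"
          "sum b (X \<union> Y) \<le> cap_out E t h c (X \<union> Y)"
          using X(1) Y by (auto intro!: less.prems(3))
        moreover have "sum b (X \<union> Y) + sum b (X \<inter> Y) = sum b X + sum b Y"
          using fY by (simp add: sum.union_inter)
        ultimately have "sum b Y < cap_out E t h c Y"
          using tight f(2) by linarith
        then show ?thesis
          using True by (simp add: b'_sum [OF fY(1)] cap')
      next
        case False
        then show ?thesis
          using less.prems(3) [OF Y] b'_sum [of Y] finite_subset [OF Y fin(1)]
          by (auto simp: cap')
      qed
      ultimately obtain y where y: "\<forall>e\<in>E. 0 \<le> y e \<and> y e \<le> c' e" "\<forall>v\<in>V. net E t h y v = b' v"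
        using less.hyps [OF small c'_ge] by blast
      show ?thesis
      proof (intro exI conjI ballI)
        fix e assume "e \<in> E"
        then show "0 \<le> (y(f := y f + 1)) e" "(y(f := y f + 1)) e \<le> c e"
          using y(1) by (fastforce simp: c'_def split: if_splits)+
      next
        fix v assume "v \<in> V"
        then show "net E t h (y(f := y f + 1)) v = b v"
          using y(2) by (simp add: net_fun_upd [OF fin(2) f(1)] b'_def)
      qed
    qed
  qed
qed

text \<open>The first flow, shifted by 1, has values in \<open>{1..4}\<close> and is conserved modulo 5; the second one
  marks the edges on which 5 is subtracted to conserve it exactly.\<close>

lemma balanced_valuation_flow:
  fixes s :: "'v \<Rightarrow> int"
  assumes fin: "finite V" "finite E" and th: "\<And>e. e \<in> E \<Longrightarrow> t e \<in> V" "\<And>e. e \<in> E \<Longrightarrow> h e \<in> V"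
    and ev: "\<And>v. v \<in> V \<Longrightarrow> even (s v + net E t h (\<lambda>_. 1) v)"
    and bal: "\<And>X. X \<subseteq> V \<Longrightarrow>
      5 * \<bar>sum s X\<bar> \<le> 3 * (cap_out E t h (\<lambda>_. 1) X + cap_out E h t (\<lambda>_. 1) X)"
  shows "\<exists>\<psi>. (\<forall>e\<in>E. \<psi> e \<noteq> 0 \<and> \<bar>\<psi> e\<bar> \<le> 4) \<and> (\<forall>v\<in>V. net E t h \<psi> v = 0)"
proof -
  define n where "n = net E t h (\<lambda>_. 1)"
  define a where "a v = (s v + n v) div 2" for v
  \<comment> \<open>The values sought are \<open>y + 1\<close>, with net outflow
    \<open>5 * a v\<close>; this leaves the demand \<open>5 * a v - n v\<close> for
    \<open>y\<close>.\<close>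
  define b where "b v = 5 * a v - n v" for v
  have a2: "2 * a v = s v + n v" if "v \<in> V" for v
    using ev [OF that] by (simp add: a_def n_def)
  have const: "cap_out E t' h' (\<lambda>_. k) X = k * cap_out E t' h' (\<lambda>_. 1) X" for t' h' k X
    by (simp add: cap_out_def sum_distrib_left)
  have n_sum: "sum n X = cap_out E t h (\<lambda>_. 1) X - cap_out E h t (\<lambda>_. 1) X" if "finite X" for X
    unfolding n_def by (rule net_sum_cap_out [OF that])
  have a_sum: "2 * sum a X = sum s X + sum n X" if "X \<subseteq> V" for X
  proof -
    have "2 * sum a X = (\<Sum>v\<in>X. s v + n v)"
      unfolding sum_distrib_left using that a2 by (intro sum.cong) auto
    then show ?thesis by (simp add: sum.distrib)
  qed
  have b_sum: "sum b X = 5 * sum a X - sum n X" for X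
    by (simp add: b_def sum_subtractf sum_distrib_left)
  have out_V: "cap_out E t h c V = 0" "cap_out E h t c V = 0" for c
    using th by (auto simp: cap_out_def)
  have sV: "sum s V = 0" "sum n V = 0"
    using bal [of V] n_sum [OF fin(1)] by (auto simp: out_V)
  \<comment> \<open>Twice the left side is \<open>5 * sum s X + 3 * sum n X\<close>, and
    \<open>sum n X\<close> counts outgoing minus incoming edges; \<open>bal\<close> bounds this by
    six times the number of outgoing edges.\<close>
  have "sum b X \<le> cap_out E t h (\<lambda>_. 3) X" if X: "X \<subseteq> V" for X
    using bal [OF X] a_sum [OF X] b_sum [of X] n_sum [OF finite_subset [OF X fin(1)]]
    by (simp add: const [of _ _ 3])
  moreover have "sum b V = 0"
    using sV a_sum [of V] by (simp add: b_sum)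
  ultimately obtain y where y: "\<forall>e\<in>E. 0 \<le> y e \<and> y e \<le> 3" "\<forall>v\<in>V. net E t h y v = b v"
    using feasible_flow [of V E t h "\<lambda>_. 3" b] fin th by auto
  define p where "p e = y e + 1" for e
  have p: "1 \<le> p e" "p e \<le> 4" if "e \<in> E" for e
    using y(1) that by (auto simp: p_def)
  have net_p: "net E t h p v = 5 * a v" if "v \<in> V" for v
  proof -
    have "net E t h p v = net E t h y v + n v"
      unfolding net_def p_def n_def by (simp add: algebra_simps sum.distrib sum_subtractf)
    then show ?thesis
      using y(2) that by (simp add: b_def)
  qed
  \<comment> \<open>Since \<open>p\<close> is nonnegative and at most 4, \<open>5 * sum a X\<close>
    is at most four times the number of outgoing edges, so unit capacities suffice for the demand
    \<open>a\<close>.\<close>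
  have "sum a X \<le> cap_out E t h (\<lambda>_. 1) X" if X: "X \<subseteq> V" for X
  proof -
    have "5 * sum a X = (\<Sum>v\<in>X. net E t h p v)"
      unfolding sum_distrib_left using X net_p by (intro sum.cong) auto
    also have "\<dots> = cap_out E t h p X - cap_out E h t p X"
      by (rule net_sum_cap_out [OF finite_subset [OF X fin(1)]])
    also have "\<dots> \<le> cap_out E t h (\<lambda>_. 4) X - 0"
      unfolding cap_out_def using p
      by (intro diff_mono sum_mono sum_nonneg mult_right_mono mult_nonneg_nonneg) force+
    also have "\<dots> = 4 * cap_out E t h (\<lambda>_. 1) X"
      by (simp add: const [of _ _ 4])
    finally have "5 * sum a X \<le> 4 * cap_out E t h (\<lambda>_. 1) X" .
    moreover have "0 \<le> cap_out E t h (\<lambda>_. 1) X"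
      by (simp add: cap_out_def sum_nonneg)
    ultimately show ?thesis by linarith
  qed
  moreover have "sum a V = 0"
    using sV a_sum [of V] by simp
  ultimately obtain z where z: "\<forall>e\<in>E. 0 \<le> z e \<and> z e \<le> 1" "\<forall>v\<in>V. net E t h z v = a v"
    using feasible_flow [of V E t h "\<lambda>_. 1" a] fin th by auto
  show ?thesis
  proof (intro exI [of _ "\<lambda>e. p e - 5 * z e"] conjI ballI)
    fix e assume e: "e \<in> E"
    then have "z e = 0 \<or> z e = 1"
      using z(1) by force
    then show "p e - 5 * z e \<noteq> 0" "\<bar>p e - 5 * z e\<bar> \<le> 4"
      using p [OF e] by auto
  next
    fix v assume v: "v \<in> V"
    have "net E t h (\<lambda>e. p e - 5 * z e) v = net E t h p v - 5 * net E t h z v"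
      unfolding net_def sum_distrib_left sum_subtractf [symmetric]
      by (rule sum.cong) (auto simp: algebra_simps)
    then show "net E t h (\<lambda>e. p e - 5 * z e) v = 0"
      using net_p [OF v] z(2) v by simp
  qed
qed

section \<open>Cuts, components and matchings\<close>

definition ecut :: "('v, 'e) multigraph \<Rightarrow> 'v set \<Rightarrow> 'e set" where
  "ecut G X = {e \<in> medges G. mends G e \<inter> X \<noteq> {} \<and> \<not> mends G e \<subseteq> X}"

definition reach :: "('v, 'e) multigraph \<Rightarrow> 'v \<Rightarrow> 'v set" where
  "reach G v = {w. (v, w) \<in> (adjacency G)\<^sup>*}"

definition induced :: "('v, 'e) multigraph \<Rightarrow> 'v set \<Rightarrow> ('v, 'e) multigraph" where
  "induced G W = \<lparr>mverts = W, medges = {e \<in> medges G. mends G e \<subseteq> W}, mends = mends G\<rparr>"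

abbreviation component_at :: "('v, 'e) multigraph \<Rightarrow> 'v \<Rightarrow> ('v, 'e) multigraph" where
  "component_at G v \<equiv> induced G (reach G v)"

lemma induced_sel [simp]:
  "mverts (induced G W) = W" "medges (induced G W) = {e \<in> medges G. mends G e \<subseteq> W}"
  "mends (induced G W) = mends G"
  by (auto simp: induced_def)

lemma delete_edges_sel [simp]:
  "mverts (delete_edges G S) = mverts G" "medges (delete_edges G S) = medges G - S"
  "mends (delete_edges G S) = mends G"
  by (auto simp: delete_edges_def)

lemma multigraphD:
  assumes "multigraph G"
  shows "finite (mverts G)" "finite (medges G)"
    "e \<in> medges G \<Longrightarrow> mends G e \<subseteq> mverts G" "e \<in> medges G \<Longrightarrow> card (mends G e) = 2"
    "e \<in> medges G \<Longrightarrow> finite (mends G e)"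
  using assms by (auto simp: multigraph_def intro: card_ge_0_finite)

lemma multigraph_edgeE:
  assumes "multigraph G" "e \<in> medges G" "x \<in> mends G e"
  obtains y where "mends G e = {x, y}" "x \<noteq> y" "x \<in> mverts G" "y \<in> mverts G"
proof -
  obtain a b where ab: "mends G e = {a, b}" "a \<noteq> b"
    using multigraphD(4) [OF assms(1,2)] by (auto simp: card_2_iff)
  with assms(3) obtain y where "mends G e = {x, y}" "x \<noteq> y"
    by (cases "x = a") (auto simp: insert_commute)
  then show ?thesis
    using that multigraphD(3) [OF assms(1,2)] by auto
qed

lemma multigraph_induced: "multigraph G \<Longrightarrow> W \<subseteq> mverts G \<Longrightarrow> multigraph (induced G W)"
  by (auto simp: multigraph_def intro: finite_subset)

lemma multigraph_delete_edges: "multigraph G \<Longrightarrow> multigraph (delete_edges G S)"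
  by (auto simp: multigraph_def)

lemma msubgraph_induced: "multigraph G \<Longrightarrow> W \<subseteq> mverts G \<Longrightarrow> msubgraph (induced G W) G"
  by (simp add: msubgraph_def multigraph_induced)

lemma adjacency_mono: "msubgraph H G \<Longrightarrow> adjacency H \<subseteq> adjacency G"
  by (auto simp: adjacency_def msubgraph_def)

lemma sym_adjacency: "sym (adjacency G)"
  by (auto simp: adjacency_def sym_def insert_commute)

lemma reach_refl [simp]: "v \<in> reach G v"
  by (simp add: reach_def)

lemma reach_sym: "w \<in> reach G v \<longleftrightarrow> v \<in> reach G w"
  using sym_rtrancl [OF sym_adjacency, of G] by (auto simp: reach_def dest: symD)

lemma reach_eq: "w \<in> reach G v \<Longrightarrow> reach G w = reach G v"
  using reach_sym [of w G v] by (auto simp: reach_def)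

lemma reach_disjoint: "reach G v \<inter> reach G w \<noteq> {} \<Longrightarrow> reach G v = reach G w"
  by (metis disjoint_iff reach_eq)

lemma reach_mono: "msubgraph H G \<Longrightarrow> reach H v \<subseteq> reach G v"
  using rtrancl_mono [OF adjacency_mono] by (auto simp: reach_def)

lemma mconnected_subset_reach: "mconnected H \<Longrightarrow> v \<in> mverts H \<Longrightarrow> mverts H \<subseteq> reach H v"
  by (auto simp: mconnected_def reach_def)

lemma edge_subset_reach:
  assumes G: "multigraph G" and e: "e \<in> medges G" "mends G e \<inter> reach G v \<noteq> {}"
  shows "mends G e \<subseteq> reach G v"
proof -
  obtain x where x: "x \<in> mends G e" "x \<in> reach G v"
    using e(2) by blast
  obtain y where y: "mends G e = {x, y}"
    using multigraph_edgeE [OF G e(1) x(1)] by blast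
  then have "(x, y) \<in> adjacency G"
    using e(1) by (auto simp: adjacency_def)
  then show ?thesis
    using x(2) y by (auto simp: reach_def)
qed

lemma reach_closed:
  assumes "ecut G X = {}" "u \<in> X"
  shows "reach G u \<subseteq> X"
proof
  fix v assume "v \<in> reach G u"
  then have "(u, v) \<in> (adjacency G)\<^sup>*"
    by (simp add: reach_def)
  then show "v \<in> X"
    using assms by induction (auto simp: adjacency_def ecut_def)
qed

lemma reach_subset: "multigraph G \<Longrightarrow> v \<in> mverts G \<Longrightarrow> reach G v \<subseteq> mverts G"
  by (rule reach_closed) (auto simp: ecut_def multigraph_def)

lemma finite_ecut: "multigraph G \<Longrightarrow> finite (ecut G X)"
  by (simp add: ecut_def multigraph_def)

text \<open>Counting incidences by edges, an edge inside \<open>X\<close> counts twice and a cut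
  edge once. This fixes the parity of cuts in cubic and in 2-regular graphs.\<close>

lemma handshake:
  assumes G: "multigraph G" and X: "X \<subseteq> mverts G"
  shows "(\<Sum>v\<in>X. mdegree G v) = card (ecut G X) + 2 * card {e \<in> medges G. mends G e \<subseteq> X}"
proof -
  have fin: "finite (medges G)" "finite X"
    using multigraphD(1,2) [OF G] X finite_subset by auto
  have "(\<Sum>v\<in>X. mdegree G v) = (\<Sum>v\<in>X. \<Sum>e\<in>medges G. of_bool (v \<in> mends G e))"
    using fin by (simp add: mdegree_def Int_def)
  also have "\<dots> = (\<Sum>e\<in>medges G. \<Sum>v\<in>X. of_bool (v \<in> mends G e))"
    by (rule sum.swap)
  also have "\<dots> = (\<Sum>e\<in>medges G. card (X \<inter> mends G e))"
    using fin by simp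
  also have "\<dots> = (\<Sum>e\<in>medges G. of_bool (e \<in> ecut G X) + 2 * of_bool (mends G e \<subseteq> X))"
  proof (rule sum.cong [OF refl])
    fix e assume e: "e \<in> medges G"
    then obtain x y where "mends G e = {x, y}" "x \<noteq> y"
      using multigraphD(4) [OF G e] by (auto simp: card_2_iff)
    then show "card (X \<inter> mends G e) = of_bool (e \<in> ecut G X) + 2 * of_bool (mends G e \<subseteq> X)"
      using e by (auto simp: ecut_def Int_insert_right)
  qed
  also have "\<dots> = card (ecut G X) + 2 * card {e \<in> medges G. mends G e \<subseteq> X}"
  proof -
    have "medges G \<inter> {e. e \<in> ecut G X} = ecut G X"
      by (auto simp: ecut_def)
    then show ?thesis
      using fin by (simp add: sum.distrib sum_distrib_left [symmetric] Int_def)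
  qed
  finally show ?thesis .
qed

text \<open>Every edge of a walk from \<open>v\<close> has both ends in \<open>reach G v\<close>, so
  the walk survives in the induced subgraph.\<close>

lemma mconnected_component_at:
  assumes "multigraph G"
  shows "mconnected (component_at G v)"
proof -
  let ?H = "component_at G v"
  have *: "(v, w) \<in> (adjacency ?H)\<^sup>*" if "w \<in> reach G v" for w
  proof -
    have "(v, w) \<in> (adjacency G)\<^sup>*"
      using that by (simp add: reach_def)
    then show ?thesis
    proof induction
      case (step y z)
      then obtain e where e: "e \<in> medges G" "mends G e = {y, z}"
        by (auto simp: adjacency_def)
      moreover have "y \<in> reach G v"
        using step by (simp add: reach_def)
      ultimately have "(y, z) \<in> adjacency ?H"
        using edge_subset_reach [OF assms e(1), of v] by (auto simp: adjacency_def)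
      with step.IH show ?case by simp
    qed simp
  qed
  have "(u, w) \<in> (adjacency ?H)\<^sup>*" if "u \<in> reach G v" "w \<in> reach G v" for u w
    using * [OF that(1)] * [OF that(2)] sym_rtrancl [OF sym_adjacency, of ?H]
    by (meson rtrancl_trans symD)
  moreover have "reach G v \<noteq> {}"
    using reach_refl by fast
  ultimately show ?thesis
    by (simp add: mconnected_def)
qed

text \<open>Maximality holds because a connected subgraph through \<open>v\<close> has all its
  vertices in \<open>reach G v\<close>, and hence only edges that are already induced.\<close>

lemma component_component_at:
  assumes G: "multigraph G" and v: "v \<in> mverts G"
  shows "component G (component_at G v)"
  unfolding component_def
proof (intro conjI allI impI)
  show "msubgraph (component_at G v) G"
    by (rule msubgraph_induced [OF G reach_subset [OF G v]])
  show "mconnected (component_at G v)"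
    by (rule mconnected_component_at [OF G])
next
  fix K assume "msubgraph K G \<and> mconnected K \<and> msubgraph (component_at G v) K"
  then have K: "msubgraph K G" "mconnected K" and HK: "msubgraph (component_at G v) K"
    by blast+
  from K(1) have K': "multigraph K" "medges K \<subseteq> medges G" "mends K = mends G"
    by (auto simp: msubgraph_def)
  from HK have sub: "reach G v \<subseteq> mverts K" "{e \<in> medges G. mends G e \<subseteq> reach G v} \<subseteq> medges K"
    unfolding msubgraph_def induced_sel by blast+
  have "mverts K \<subseteq> reach G v"
    using mconnected_subset_reach [of K v] reach_mono [of K G v] K reach_refl [of v G] sub(1) by blast
  with sub(1) have verts: "mverts K = reach G v"
    by blast
  have "medges K = {e \<in> medges G. mends G e \<subseteq> reach G v}"
    using K'(2) sub(2) multigraphD(3) [OF K'(1)] unfolding verts K'(3) by blast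
  with verts K'(3) show "K = component_at G v"
    by (cases K) (simp add: induced_def)
qed

text \<open>No edge leaves \<open>reach F v\<close>, so degrees in the component are those in
  \<open>F\<close>.\<close>

lemma mcycle_component_at:
  assumes F: "multigraph F" "regular 2 F" and v: "v \<in> mverts F"
  shows "mcycle F (component_at F v)"
proof -
  have "mdegree (component_at F v) u = mdegree F u" if "u \<in> reach F v" for u
  proof -
    have "{e \<in> medges (component_at F v). u \<in> mends (component_at F v) e} =
        {e \<in> medges F. u \<in> mends F e}"
      using edge_subset_reach [OF F(1), of _ v] that by auto
    then show ?thesis by (simp add: mdegree_def)
  qed
  then have "regular 2 (component_at F v)"
    using F(2) reach_subset [OF F(1) v] by (auto simp: regular_def)
  then show ?thesis
    using mconnected_component_at [OF F(1)] msubgraph_induced [OF F(1) reach_subset [OF F(1) v]]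
    by (simp add: mcycle_def)
qed

section \<open>Matchings and the vertices they cover\<close>

definition mmatching :: "('v, 'e) multigraph \<Rightarrow> 'e set \<Rightarrow> bool" where
  "mmatching G N \<longleftrightarrow> N \<subseteq> medges G \<and> pairwise (\<lambda>e f. disjnt (mends G e) (mends G f)) N"

definition covered :: "('v, 'e) multigraph \<Rightarrow> 'e set \<Rightarrow> 'v set" where
  "covered G N = (\<Union>e\<in>N. mends G e)"

definition max_matching :: "('v, 'e) multigraph \<Rightarrow> 'e set \<Rightarrow> bool" where
  "max_matching G N \<longleftrightarrow> mmatching G N \<and> (\<forall>N'. mmatching G N' \<longrightarrow> card N' \<le> card N)"

lemma mmatching_unique:
  "mmatching G N \<Longrightarrow> e \<in> N \<Longrightarrow> f \<in> N \<Longrightarrow> x \<in> mends G e \<Longrightarrow> x \<in> mends G f \<Longrightarrow> e = f"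
  by (auto simp: mmatching_def pairwise_def disjnt_def)

lemma mmatching_subset: "mmatching G N \<Longrightarrow> N' \<subseteq> N \<Longrightarrow> mmatching G N'"
  by (auto simp: mmatching_def intro: pairwise_subset)

lemma mmatching_insert:
  "mmatching G N \<Longrightarrow> e \<in> medges G \<Longrightarrow> mends G e \<inter> covered G N = {} \<Longrightarrow> mmatching G (insert e N)"
  by (auto simp: mmatching_def covered_def pairwise_insert disjnt_def)

lemma finite_mmatching: "multigraph G \<Longrightarrow> mmatching G N \<Longrightarrow> finite N"
  by (auto simp: mmatching_def multigraph_def intro: finite_subset)

lemma covered_subset: "multigraph G \<Longrightarrow> mmatching G N \<Longrightarrow> covered G N \<subseteq> mverts G"
  by (auto simp: mmatching_def covered_def multigraph_def)

lemma card_covered: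
  assumes "multigraph G" "mmatching G N"
  shows "card (covered G N) = 2 * card N"
proof -
  have "mends G e \<inter> mends G f = {}" if "e \<in> N" "f \<in> N" "e \<noteq> f" for e f
    using mmatching_unique [OF assms(2)] that by blast
  moreover have "finite (mends G e)" if "e \<in> N" for e
    using assms that by (auto simp: mmatching_def intro: multigraphD(5))
  ultimately have "card (covered G N) = (\<Sum>e\<in>N. card (mends G e))"
    unfolding covered_def using finite_mmatching [OF assms] by (intro card_UN_disjoint) auto
  also have "\<dots> = (\<Sum>e\<in>N. 2)"
    using assms by (intro sum.cong) (auto simp: mmatching_def multigraphD)
  finally show ?thesis by simp
qed

lemma max_matching_exists:
  assumes "multigraph G"
  obtains N where "max_matching G N"
proof -
  have "card N < Suc (card (medges G))" if "mmatching G N" for N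
    using that multigraphD(2) [OF assms] by (simp add: mmatching_def card_mono less_Suc_eq_le)
  moreover have "mmatching G {}"
    by (simp add: mmatching_def)
  ultimately have "\<exists>N. mmatching G N \<and> (\<forall>N'. mmatching G N' \<longrightarrow> card N' \<le> card N)"
    using ex_has_greatest_nat [of "mmatching G" "{}" card "Suc (card (medges G))"] by blast
  then show ?thesis
    using that by (auto simp: max_matching_def)
qed

lemma max_matching_edge_covered:
  assumes G: "multigraph G" and N: "max_matching G N" and e: "e \<in> medges G"
  shows "mends G e \<inter> covered G N \<noteq> {}"
proof
  assume *: "mends G e \<inter> covered G N = {}"
  then have "mmatching G (insert e N)"
    using N e by (auto simp: max_matching_def intro: mmatching_insert)
  then have "card (insert e N) \<le> card N"
    using N by (simp add: max_matching_def)
  moreover have "e \<notin> N"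
  proof
    assume "e \<in> N"
    then have "mends G e = {}"
      using * by (auto simp: covered_def)
    then show False
      using multigraphD(4) [OF G e] by simp
  qed
  ultimately show False
    using N finite_mmatching [OF G] by (auto simp: max_matching_def)
qed

lemma max_matching_card_eq: "max_matching G N \<Longrightarrow> mmatching G N' \<Longrightarrow> card N' = card N \<Longrightarrow> max_matching G N'"
  by (simp add: max_matching_def)

lemma covered_diff:
  assumes "mmatching G N" "e \<in> N"
  shows "covered G (N - {e}) = covered G N - mends G e"
  using mmatching_unique [OF assms(1) assms(2)] by (fastforce simp: covered_def)

text \<open>The matching edges inside the component pair off all its vertices except
  \<open>v\<close>.\<close>

lemma odd_card_reach:
  assumes G: "multigraph G" and N: "mmatching G N" and v: "v \<in> mverts G"
    and unc: "reach G v - covered G N = {v}"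
  shows "odd (card (reach G v))"
proof -
  let ?K = "reach G v" and ?N = "{e \<in> N. mends G e \<subseteq> reach G v}"
  have N': "mmatching G ?N"
    using N by (rule mmatching_subset) auto
  have "covered G ?N = ?K - {v}"
  proof (intro subset_antisym subsetI)
    fix x assume x: "x \<in> ?K - {v}"
    then obtain e where e: "e \<in> N" "x \<in> mends G e"
      using unc by (auto simp: covered_def)
    then have "mends G e \<subseteq> ?K"
      using x N by (intro edge_subset_reach [OF G]) (auto simp: mmatching_def)
    then show "x \<in> covered G ?N"
      using e by (auto simp: covered_def)
  qed (use unc in \<open>auto simp: covered_def\<close>)
  then have "card (?K - {v}) = 2 * card ?N"
    using card_covered [OF G N'] by simp
  moreover have "finite ?K"
    using reach_subset [OF G v] multigraphD(1) [OF G] finite_subset by blast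
  ultimately have "card ?K = Suc (2 * card ?N)"
    by (metis card_Suc_Diff1 reach_refl)
  then show ?thesis by simp
qed

section \<open>Petersen's theorem\<close>

text \<open>Gallai's exchange argument: among the maximum matchings missing \<open>t\<close>, take one closest to \<open>M\<close>.\<close>

lemma missed_together_trans:
  assumes G: "multigraph G"
    and t: "max_matching G N0" "t \<notin> covered G N0"
    and ut: "\<And>N. max_matching G N \<Longrightarrow> u \<notin> covered G N \<Longrightarrow> t \<notin> covered G N \<Longrightarrow> u = t"
    and tv: "\<And>N. max_matching G N \<Longrightarrow> t \<notin> covered G N \<Longrightarrow> v \<notin> covered G N \<Longrightarrow> t = v"
    and M: "max_matching G M" "u \<notin> covered G M" "v \<notin> covered G M"
  shows "u = v"
proof (rule ccontr)
  assume "u \<noteq> v"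
  then have tM: "t \<in> covered G M"
    using ut tv M by blast
  have mM: "mmatching G M"
    using M(1) by (simp add: max_matching_def)
  have finM: "finite M"
    by (rule finite_mmatching [OF G mM])
  let ?P = "\<lambda>N. max_matching G N \<and> t \<notin> covered G N"
  have "\<exists>N. ?P N \<and> (\<forall>N'. ?P N' \<longrightarrow> card (M \<inter> N') \<le> card (M \<inter> N))"
  proof (rule ex_has_greatest_nat [of ?P N0 "\<lambda>N. card (M \<inter> N)" "Suc (card M)"])
    show "\<forall>N. ?P N \<longrightarrow> card (M \<inter> N) < Suc (card M)"
      using finM by (auto simp: less_Suc_eq_le intro: card_mono)
  qed (use t in blast)
  then obtain N where N: "max_matching G N" "t \<notin> covered G N"
      and closest: "\<And>N'. max_matching G N' \<Longrightarrow> t \<notin> covered G N' \<Longrightarrow> card (M \<inter> N') \<le> card (M \<inter> N)"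
    by blast
  have mN: "mmatching G N"
    using N(1) by (simp add: max_matching_def)
  have uvN: "u \<in> covered G N" "v \<in> covered G N"
    using ut [OF N(1)] tv [OF N(1)] N(2) tM M(2,3) by metis+
  have fin: "finite (covered G M)" "finite (covered G N)"
    using covered_subset [OF G mM] covered_subset [OF G mN] multigraphD(1) [OF G] finite_subset by auto
  have "card N = card M"
    using M(1) N(1) mM mN by (meson antisym max_matching_def)
  then have "card (covered G M) = card (covered G N)"
    using card_covered [OF G mM] card_covered [OF G mN] by simp
  then have eq: "card (covered G M - covered G N) = card (covered G N - covered G M)"
    using fin by (simp add: card_Diff_subset_Int Int_commute)
  \<comment> \<open>\<open>N\<close> covers \<open>u\<close> and \<open>v\<close>, which
    \<open>M\<close> misses. As both matchings cover equally many vertices, \<open>M\<close> covers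
    at least two vertices missed by \<open>N\<close>, hence one besides \<open>t\<close>.\<close>
  have "card {u, v} \<le> card (covered G N - covered G M)"
    using uvN M(2,3) fin by (intro card_mono) auto
  with \<open>u \<noteq> v\<close> eq have "2 \<le> card (covered G M - covered G N)"
    by simp
  moreover have "card (covered G M - covered G N) \<le> 1" if "covered G M - covered G N \<subseteq> {t}"
    using card_mono [OF _ that] by simp
  ultimately obtain x where x: "x \<in> covered G M" "x \<notin> covered G N" "x \<noteq> t"
    by fastforce
  then obtain e where e: "e \<in> M" "x \<in> mends G e"
    by (auto simp: covered_def)
  then have eE: "e \<in> medges G"
    using mM by (auto simp: mmatching_def)
  obtain y where y: "mends G e = {x, y}"
    using multigraph_edgeE [OF G eE e(2)] by blast
  have yN: "y \<in> covered G N"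
    using max_matching_edge_covered [OF G N(1) eE] x(2) y by auto
  then obtain f where f: "f \<in> N" "y \<in> mends G f"
    by (auto simp: covered_def)
  have eN: "e \<notin> N"
    using x(2) e(2) by (auto simp: covered_def)
  have fM: "f \<notin> M"
    using mmatching_unique [OF mM e(1), of f y] f y eN by auto
  \<comment> \<open>Exchanging \<open>f\<close> for \<open>e\<close> gains an edge of
    \<open>M\<close>. The vertex \<open>t\<close> stays missed: it differs from \<open>x\<close> by
    choice, and from \<open>y\<close> because \<open>N\<close> covers \<open>y\<close>.\<close>
  let ?N = "insert e (N - {f})"
  have cov: "covered G (N - {f}) = covered G N - mends G f"
    by (rule covered_diff [OF mN f(1)])
  have "mends G e \<inter> covered G (N - {f}) = {}"
    unfolding cov y using x(2) f(2) by blast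
  then have "mmatching G ?N"
    by (rule mmatching_insert [OF mmatching_subset [OF mN Diff_subset] eE])
  moreover have "card ?N = card N"
    using eN card_Suc_Diff1 [OF finite_mmatching [OF G mN] f(1)] finite_mmatching [OF G mN] by simp
  ultimately have "max_matching G ?N"
    by (rule max_matching_card_eq [OF N(1)])
  moreover have "t \<notin> covered G ?N"
  proof -
    have "covered G ?N = mends G e \<union> covered G (N - {f})"
      by (simp add: covered_def)
    then show ?thesis
      using cov N(2) x(3) y yN by auto
  qed
  ultimately have "card (M \<inter> ?N) \<le> card (M \<inter> N)"
    by (rule closest)
  moreover have "M \<inter> ?N = insert e (M \<inter> N)"
    using e(1) fM by auto
  ultimately show False
    using eN finM by simp
qed

text \<open>Two adjacent vertices are never both missed by a maximum matching. Since every vertex is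
  missed by some maximum matching, \<open>missed_together_trans\<close> extends this along a walk
  from \<open>u\<close> to \<open>v\<close>.\<close>

lemma gallai_lemma:
  assumes G: "multigraph G"
    and missed: "\<And>v. v \<in> mverts G \<Longrightarrow> \<exists>N. max_matching G N \<and> v \<notin> covered G N"
    and N: "max_matching G N" "u \<notin> covered G N" "v \<notin> covered G N"
    and uv: "u \<in> mverts G" "v \<in> reach G u"
  shows "u = v"
proof -
  have "(u, v) \<in> (adjacency G)\<^sup>*"
    using uv(2) by (simp add: reach_def)
  then have "\<forall>N. max_matching G N \<longrightarrow> u \<notin> covered G N \<longrightarrow> v \<notin> covered G N \<longrightarrow> u = v"
  proof induction
    case (step y z)
    then obtain e where e: "e \<in> medges G" "mends G e = {y, z}"
      by (auto simp: adjacency_def)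
    then have "y \<in> mverts G"
      using multigraphD(3) [OF G e(1)] by simp
    then obtain N0 where N0: "max_matching G N0" "y \<notin> covered G N0"
      using missed by blast
    have "y = z" if "max_matching G N" "y \<notin> covered G N" "z \<notin> covered G N" for N
      using max_matching_edge_covered [OF G that(1) e(1)] e(2) that by auto
    then show ?case
      using missed_together_trans [OF G N0] step.IH by meson
  qed simp
  then show ?thesis
    using N by blast
qed

section \<open>Tutte-Berge sets and perfect matchings of bridgeless cubic graphs\<close>

lemma mmatching_induced:
  "mmatching (induced G W) N \<longleftrightarrow> mmatching G N \<and> covered G N \<subseteq> W"
  by (auto simp: mmatching_def covered_def)

lemma covered_induced [simp]: "covered (induced G W) N = covered G N"
  by (simp add: covered_def)

text \<open>A single cut edge would be a bridge: once it is deleted, nothing outside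
  \<open>X\<close> can be reached from its end in \<open>X\<close>.\<close>

lemma bridgeless_card_ecut:
  assumes G: "multigraph G" "bridgeless G"
  shows "card (ecut G X) \<noteq> 1"
proof
  assume "card (ecut G X) = 1"
  then obtain e where e: "ecut G X = {e}"
    by (auto simp: card_1_singleton_iff)
  then have eE: "e \<in> medges G" "mends G e \<inter> X \<noteq> {}" "\<not> mends G e \<subseteq> X"
    by (auto simp: ecut_def)
  then obtain x where x: "x \<in> mends G e" "x \<in> X"
    by blast
  obtain y where y: "mends G e = {x, y}"
    using multigraph_edgeE [OF G(1) eE(1) x(1)] by blast
  then have "y \<notin> X"
    using eE(3) x(2) by simp
  moreover have "ecut (delete_edges G {e}) X = {}"
    using e by (auto simp: ecut_def)
  then have "reach (delete_edges G {e}) x \<subseteq> X"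
    using x(2) by (rule reach_closed)
  ultimately have "(x, y) \<notin> (adjacency (delete_edges G {e}))\<^sup>*"
    by (auto simp: reach_def)
  then have "bridge G e"
    using eE(1) y by (auto simp: bridge_def)
  then show False
    using G(2) by (simp add: bridgeless_def)
qed

lemma cubic_sum_degrees: "cubic G \<Longrightarrow> X \<subseteq> mverts G \<Longrightarrow> (\<Sum>v\<in>X. mdegree G v) = 3 * card X"
  by (simp add: cubic_def regular_def subset_iff)

text \<open>Take \<open>U\<close> of largest size: a vertex covered by all maximum matchings of \<open>G - U\<close> could be added.\<close>

lemma tutte_berge_set:
  assumes G: "multigraph G" and M: "max_matching G M"
  obtains U N where "U \<subseteq> mverts G" "max_matching (induced G (mverts G - U)) N"
    "card N + card U = card M"
    "\<And>v. v \<in> mverts G - U \<Longrightarrow> \<exists>N. max_matching (induced G (mverts G - U)) N \<and> v \<notin> covered G N"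
proof -
  let ?V = "mverts G"
  let ?Q = "\<lambda>U. U \<subseteq> ?V \<and> (\<exists>N. max_matching (induced G (?V - U)) N \<and> card N + card U = card M)"
  have "max_matching (induced G (?V - {})) M"
    using M covered_subset [OF G] by (auto simp: max_matching_def mmatching_induced)
  then have "?Q {}"
    by auto
  moreover have "\<forall>U. ?Q U \<longrightarrow> card U < Suc (card ?V)"
    using multigraphD(1) [OF G] by (auto simp: less_Suc_eq_le intro: card_mono)
  ultimately have "\<exists>U. ?Q U \<and> (\<forall>U'. ?Q U' \<longrightarrow> card U' \<le> card U)"
    by (rule ex_has_greatest_nat)
  then obtain U N where U: "U \<subseteq> ?V" "max_matching (induced G (?V - U)) N" "card N + card U = card M"
    and greatest: "\<And>U'. ?Q U' \<Longrightarrow> card U' \<le> card U"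
    by blast
  let ?H = "induced G (?V - U)"
  have H: "multigraph ?H"
    by (rule multigraph_induced [OF G]) auto
  have finU: "finite U"
    using U(1) multigraphD(1) [OF G] finite_subset by blast
  have "\<exists>N. max_matching ?H N \<and> v \<notin> covered G N" if v: "v \<in> ?V - U" for v
  proof (rule ccontr)
    assume "\<not> ?thesis"
    then have cov: "v \<in> covered G N'" if "max_matching ?H N'" for N'
      using that by blast
    obtain e where e: "e \<in> N" "v \<in> mends G e"
      using cov [OF U(2)] by (auto simp: covered_def)
    have mN: "mmatching G N" "covered G N \<subseteq> ?V - U"
      using U(2) by (auto simp: max_matching_def mmatching_induced)
    have finN: "finite N"
      by (rule finite_mmatching [OF G mN(1)])
    have card_N: "card N = Suc (card (N - {e}))"
      using card_Suc_Diff1 [OF finN e(1)] by simp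
    \<comment> \<open>As every maximum matching of \<open>?H\<close> covers \<open>v\<close>,
      deleting \<open>v\<close> lowers the matching number by exactly one, which preserves the
      cardinality equation for \<open>insert v U\<close>.\<close>
    have "max_matching (induced G (?V - insert v U)) (N - {e})"
      unfolding max_matching_def
    proof (intro conjI allI impI)
      show "mmatching (induced G (?V - insert v U)) (N - {e})"
        using mN e mmatching_subset [OF mN(1)] covered_diff [OF mN(1) e(1)]
        by (auto simp: mmatching_induced)
    next
      fix N' assume "mmatching (induced G (?V - insert v U)) N'"
      then have N': "mmatching ?H N'" "v \<notin> covered G N'"
        by (auto simp: mmatching_induced)
      then have "card N' \<noteq> card N"
        using max_matching_card_eq [OF U(2)] cov by blast
      moreover have "card N' \<le> card N"
        using N'(1) U(2) by (simp add: max_matching_def)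
      ultimately show "card N' \<le> card (N - {e})"
        using card_N by simp
    qed
    moreover have "card (N - {e}) + card (insert v U) = card M"
      using v finU card_N U(3) by simp
    ultimately have "card (insert v U) \<le> card U"
      using v U(1) by (intro greatest) blast
    then show False
      using v finU by simp
  qed
  with that U show thesis by blast
qed

text \<open>If a maximum matching were not perfect, more than \<open>card U\<close> components of
  \<open>G - U\<close> would contain a missed vertex. Each of them has odd order and so sends at
  least three edges to \<open>U\<close>, by parity and the absence of bridges, but \<open>U\<close>
  can receive at most \<open>3 * card U\<close>.\<close>

theorem petersen:
  assumes G: "multigraph G" "cubic G" "bridgeless G"
  obtains M where "mmatching G M" "covered G M = mverts G"
proof -
  let ?V = "mverts G"
  obtain M where M: "max_matching G M"
    using max_matching_exists [OF G(1)] .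
  then have mM: "mmatching G M"
    by (simp add: max_matching_def)
  have "covered G M = ?V"
  proof (rule ccontr)
    assume "covered G M \<noteq> ?V"
    then have "covered G M \<subset> ?V"
      using covered_subset [OF G(1) mM] by blast
    then have less: "2 * card M < card ?V"
      using psubset_card_mono [OF multigraphD(1) [OF G(1)]] card_covered [OF G(1) mM] by metis
    obtain U N where U: "U \<subseteq> ?V" and N: "max_matching (induced G (?V - U)) N"
      and cards: "card N + card U = card M"
      and missed: "\<And>v. v \<in> ?V - U \<Longrightarrow> \<exists>N. max_matching (induced G (?V - U)) N \<and> v \<notin> covered G N"
      using tutte_berge_set [OF G(1) M] by blast
    define H where "H = induced G (?V - U)"
    have H: "multigraph H" "mverts H = ?V - U"
      using multigraph_induced [OF G(1)] by (auto simp: H_def)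
    have mN: "mmatching G N" "mmatching H N" "covered G N \<subseteq> ?V - U"
      using N by (auto simp: max_matching_def mmatching_induced H_def)
    define W where "W = ?V - U - covered G N"
    have fin: "finite ?V" "finite U" "finite (covered G N)" "finite W"
      using multigraphD(1) [OF G(1)] finite_subset [OF U] finite_subset [OF mN(3)]
      by (auto simp: W_def)
    have "card W = card ?V - card U - 2 * card N"
      using U fin mN(3) by (simp add: W_def card_Diff_subset card_covered [OF G(1) mN(1)])
    \<comment> \<open>This combines \<open>2 * card M < card ?V\<close> with
      \<open>card N + card U = card M\<close>.\<close>
    then have card_W: "card U < card W"
      using less cards by linarith
    have single: "w = w'" if "w \<in> W" "w' \<in> W" "w' \<in> reach H w" for w w'
      using gallai_lemma [OF H(1), of N w w'] missed N that by (auto simp: H_def W_def)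
    have K: "reach H w \<subseteq> ?V - U" if "w \<in> W" for w
      using reach_subset [OF H(1), of w] that by (auto simp: H W_def)
    \<comment> \<open>An edge leaving a component of \<open>H\<close> must end in \<open>U\<close>,
      since otherwise it would be an edge of \<open>H\<close>.\<close>
    have cut_U: "mends G e \<inter> (?V - U) \<subseteq> reach H w" "e \<in> ecut G U"
      if w: "w \<in> W" and e: "e \<in> ecut G (reach H w)" for w e
    proof -
      have eE: "e \<in> medges G" "\<not> mends G e \<subseteq> reach H w"
        using e by (auto simp: ecut_def)
      obtain x where x: "x \<in> mends G e" "x \<in> reach H w"
        using e by (auto simp: ecut_def)
      obtain y where y: "mends G e = {x, y}" "y \<in> ?V"
        using multigraph_edgeE [OF G(1) eE(1) x(1)] by blast
      have "y \<in> U"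
      proof (rule ccontr)
        assume "y \<notin> U"
        then have "e \<in> medges H"
          using eE(1) y x(2) K [OF w] by (auto simp: H_def)
        then show False
          using edge_subset_reach [OF H(1), of e w] eE(2) x by (auto simp: H_def)
      qed
      then show "mends G e \<inter> (?V - U) \<subseteq> reach H w" "e \<in> ecut G U"
        using eE(1) y x K [OF w] by (auto simp: ecut_def)
    qed
    have ge3: "3 \<le> card (ecut G (reach H w))" if w: "w \<in> W" for w
    proof -
      have "reach H w - covered H N = {w}"
        using single [OF w] w K [OF w] by (auto simp: W_def H_def)
      then have odd: "odd (card (reach H w))"
        using w by (intro odd_card_reach [OF H(1) mN(2)]) (auto simp: W_def H)
      have sub: "reach H w \<subseteq> ?V"
        using K [OF w] by blast
      \<comment> \<open>With an odd number of vertices of degree 3, the cut is odd; as it is not 1,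
        it is at least 3.\<close>
      have "3 * card (reach H w)
          = card (ecut G (reach H w)) + 2 * card {e \<in> medges G. mends G e \<subseteq> reach H w}"
        using handshake [OF G(1) sub] cubic_sum_degrees [OF G(2) sub] by simp
      with odd have "odd (card (ecut G (reach H w)))"
        by presburger
      moreover have "card (ecut G (reach H w)) \<noteq> 1"
        by (rule bridgeless_card_ecut [OF G(1,3)])
      ultimately show ?thesis
        by presburger
    qed
    \<comment> \<open>A common cut edge would have its only end outside \<open>U\<close> in both
      components, which \<open>single\<close> forbids.\<close>
    have disj: "ecut G (reach H w) \<inter> ecut G (reach H w') = {}"
      if w: "w \<in> W" "w' \<in> W" "w \<noteq> w'" for w w'
    proof (rule ccontr)
      assume "\<not> ?thesis"
      then obtain e where e: "e \<in> ecut G (reach H w)" "e \<in> ecut G (reach H w')"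
        by blast
      then obtain x where "x \<in> mends G e" "x \<in> reach H w'"
        by (auto simp: ecut_def)
      moreover from this have "x \<in> reach H w"
        using cut_U(1) [OF w(1) e(1)] K [OF w(2)] by blast
      ultimately have "w' \<in> reach H w"
        using reach_eq [of x H w] reach_eq [of x H w'] reach_refl [of w' H] by simp
      then show False
        using single w by blast
    qed
    have "3 * card W = (\<Sum>w\<in>W. 3)"
      by simp
    also have "\<dots> \<le> (\<Sum>w\<in>W. card (ecut G (reach H w)))"
      using ge3 by (rule sum_mono)
    also have "\<dots> = card (\<Union>w\<in>W. ecut G (reach H w))"
      using disj by (intro card_UN_disjoint [symmetric] fin) (auto simp: finite_ecut [OF G(1)])
    also have "\<dots> \<le> card (ecut G U)"
      using cut_U(2) by (intro card_mono finite_ecut [OF G(1)]) blast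
    also have "\<dots> \<le> 3 * card U"
      using handshake [OF G(1) U] cubic_sum_degrees [OF G(2) U] by simp
    finally show False
      using card_W by simp
  qed
  with mM that show thesis by blast
qed

section \<open>Two-factors and balanced valuations\<close>

text \<open>Two \<open>P\<close>-edges joined by a \<open>Q\<close>-edge are replaced by a single \<open>P\<close>-edge between their outer
  ends; a colouring of the smaller configuration extends uniquely.\<close>

lemma matchings_union_bipartite:
  fixes P Q :: "'v set set"
  assumes "finite Q" "\<And>p. p \<in> P \<union> Q \<Longrightarrow> card p = 2"
    "pairwise disjnt P" "pairwise disjnt Q" "\<Union>Q \<subseteq> \<Union>P"
  shows "\<exists>c :: 'v \<Rightarrow> bool. \<forall>p\<in>P \<union> Q. \<forall>x\<in>p. \<forall>y\<in>p. x \<noteq> y \<longrightarrow> c x \<noteq> c y"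
  using assms
proof (induction "card Q" arbitrary: P Q)
  case 0
  then have "Q = {}"
    by simp
  \<comment> \<open>Without \<open>Q\<close> the edges of \<open>P\<close> are independent: the end
    picked by \<open>SOME\<close> is coloured \<open>True\<close>, the other one
    \<open>False\<close>.\<close>
  define c where "c x \<longleftrightarrow> (\<exists>p\<in>P. x \<in> p \<and> x = (SOME a. a \<in> p))" for x
  have c_eq: "c x \<longleftrightarrow> x = (SOME a. a \<in> p)" if "p \<in> P" "x \<in> p" for p x
    using 0(4) that unfolding c_def by (metis disjnt_iff pairwiseD)
  have "c x \<noteq> c y" if "p \<in> P" "x \<in> p" "y \<in> p" "x \<noteq> y" for p x y
  proof -
    have "p = {x, y}"
      using 0(3) [of p] that by (auto simp: card_2_iff)
    moreover have "(SOME a. a \<in> p) \<in> p"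
      using that(2) by (rule someI)
    ultimately show ?thesis
      using c_eq [OF that(1,2)] c_eq [OF that(1,3)] that(4) by auto
  qed
  then show ?case
    using \<open>Q = {}\<close> by blast
next
  case (Suc n)
  then obtain q where q: "q \<in> Q"
    by (metis card.empty ex_in_conv nat.distinct(1))
  then obtain x y where xy: "q = {x, y}" "x \<noteq> y"
    using Suc.prems(2) [of q] by (auto simp: card_2_iff)
  have disjP: "p = p'" if "p \<in> P" "p' \<in> P" "z \<in> p" "z \<in> p'" for p p' z
    using Suc.prems(3) that by (metis disjnt_iff pairwiseD)
  have disjQ: "p = p'" if "p \<in> Q" "p' \<in> Q" "z \<in> p" "z \<in> p'" for p p' z
    using Suc.prems(4) that by (metis disjnt_iff pairwiseD)
  let ?Q = "Q - {q}"
  have IH: "\<exists>c :: 'v \<Rightarrow> bool. \<forall>p\<in>P' \<union> ?Q. \<forall>x\<in>p. \<forall>y\<in>p. x \<noteq> y \<longrightarrow> c x \<noteq> c y"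
    if "\<And>p. p \<in> P' \<Longrightarrow> card p = 2" "pairwise disjnt P'" "\<Union>?Q \<subseteq> \<Union>P'" for P'
  proof (rule Suc(1))
    show "n = card ?Q"
      using Suc(2) Suc.prems(1) q by simp
    show "pairwise disjnt ?Q"
      using Suc.prems(4) by (rule pairwise_subset) auto
  qed (use that Suc.prems in auto)
  have avoid: "x \<notin> p" "y \<notin> p" if "p \<in> ?Q" for p
    using disjQ [OF q, of p] that xy by auto
  obtain p p' where p: "p \<in> P" "x \<in> p" and p': "p' \<in> P" "y \<in> p'"
    using Suc.prems(5) q xy by blast
  show ?case
  proof (cases "q \<in> P")
    case True
    \<comment> \<open>An edge in both matchings meets no other edge; it is dropped from both, and
      its ends receive opposite colours afterwards.\<close>
    have pq: "p' = q" if "p' \<in> P" "x \<in> p' \<or> y \<in> p'" for p'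
      using disjP [OF that(1) True] that(2) xy by auto
    have "\<exists>c :: 'v \<Rightarrow> bool. \<forall>p\<in>(P - {q}) \<union> ?Q. \<forall>x\<in>p. \<forall>y\<in>p. x \<noteq> y \<longrightarrow> c x \<noteq> c y"
    proof (rule IH)
      show "pairwise disjnt (P - {q})"
        using Suc.prems(3) by (rule pairwise_subset) auto
      show "\<Union>?Q \<subseteq> \<Union>(P - {q})"
        using Suc.prems(5) avoid xy by fastforce
    qed (use Suc.prems in auto)
    then obtain c :: "'v \<Rightarrow> bool" 
        where "\<forall>p\<in>(P - {q}) \<union> ?Q. \<forall>x\<in>p. \<forall>y\<in>p. x \<noteq> y \<longrightarrow> c x \<noteq> c y"
      by (elim exE)
    note c = this [rule_format]
    define c' where "c' = c(x := True, y := False)"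
    have "c' a \<noteq> c' b" if r: "r \<in> P \<union> Q" "a \<in> r" "b \<in> r" "a \<noteq> b" for r a b
    proof (cases "r = q")
      case True
      with r xy show ?thesis
        by (auto simp: c'_def)
    next
      case False
      then have r': "r \<in> (P - {q}) \<union> ?Q" and "x \<notin> r" "y \<notin> r"
        using r(1) avoid pq by blast+
      then have "c' a = c a" "c' b = c b"
        using r(2,3) by (auto simp: c'_def)
      with c [OF r' r(2-4)] show ?thesis
        by simp
    qed
    then show ?thesis
      by blast
  next
    case False
    obtain x' where x': "p = {x, x'}" "x \<noteq> x'"
      using p Suc.prems(2) [of p] by (auto simp: card_2_iff)
    obtain y' where y': "p' = {y, y'}" "y \<noteq> y'"
      using p' Suc.prems(2) [of p'] by (auto simp: card_2_iff)
    have "p \<noteq> p'"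
      using False p(1) x' y' xy by auto
    then have ne: "x' \<noteq> y" "y' \<noteq> x" "x' \<noteq> y'"
      using disjP [OF p(1) p'(1)] x' y' by auto
    let ?P = "insert {x', y'} (P - {p, p'})"
    have other: "x \<notin> r" "y \<notin> r" "x' \<notin> r" "y' \<notin> r" if "r \<in> P - {p, p'}" for r
      using disjP [OF p(1), of r] disjP [OF p'(1), of r] that x' y' by auto
    have "\<exists>c :: 'v \<Rightarrow> bool. \<forall>p\<in>?P \<union> ?Q. \<forall>x\<in>p. \<forall>y\<in>p. x \<noteq> y \<longrightarrow> c x \<noteq> c y"
    proof (rule IH)
      show "pairwise disjnt ?P"
        using Suc.prems(3) other by (auto simp: pairwise_insert disjnt_iff intro: pairwise_subset)
      show "\<Union>?Q \<subseteq> \<Union>?P"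
      proof
        fix z assume "z \<in> \<Union>?Q"
        then have "z \<in> \<Union>P" "z \<noteq> x" "z \<noteq> y"
          using Suc.prems(5) avoid by auto
        then show "z \<in> \<Union>?P"
          using x' y' by auto
      qed
    qed (use Suc.prems ne in auto)
    then obtain c :: "'v \<Rightarrow> bool" 
        where "\<forall>p\<in>?P \<union> ?Q. \<forall>x\<in>p. \<forall>y\<in>p. x \<noteq> y \<longrightarrow> c x \<noteq> c y"
      by (elim exE)
    note c = this [rule_format]
    define c' where "c' = c(x := \<not> c x', y := \<not> c y')"
    have c'_eq: "c' z = c z" if "z \<noteq> x" "z \<noteq> y" for z
      using that by (simp add: c'_def)
    have c'_xy: "c' x = (\<not> c x')" "c' y = (\<not> c y')"
      using xy(2) by (auto simp: c'_def)
    \<comment> \<open>The outer ends are joined in \<open>?P\<close> and so differ; hence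
      \<open>x\<close> and \<open>y\<close>, coloured oppositely to them, differ as \<open>q\<close>
      requires.\<close>
    have cxy: "c x' \<noteq> c y'"
      using c [of "{x', y'}" x' y'] ne by blast
    have "c' a \<noteq> c' b" if r: "r \<in> P \<union> Q" "a \<in> r" "b \<in> r" "a \<noteq> b" for r a b
    proof -
      consider "r = p" | "r = p'" | "r = q" | "r \<in> P - {p, p'}" | "r \<in> ?Q"
        using r(1) by blast
      then show ?thesis
      proof cases
        case 1
        with r x' ne show ?thesis by (auto simp: c'_xy c'_eq)
      next
        case 2
        with r y' ne show ?thesis by (auto simp: c'_xy c'_eq)
      next
        case 3
        with r xy cxy show ?thesis by (auto simp: c'_xy)
      next
        case 4
        with r other [OF 4] c [of r a b] show ?thesis by (metis c'_eq UnI1 insertCI)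
      next
        case 5
        with r avoid [OF 5] c [of r a b] show ?thesis by (metis c'_eq UnI2)
      qed
    qed
    then show ?thesis
      by blast
  qed
qed

text \<open>Shifting the matching along the walk moves an uncovered vertex by two steps.\<close>

lemma two_regular_missed_unique:
  assumes F: "multigraph F" "regular 2 F"
    and N: "max_matching F N" "u \<notin> covered F N" "v \<notin> covered F N"
    and v: "v \<in> reach F u"
  shows "u = v"
proof -
  obtain L where "(u, v) \<in> adjacency F ^^ L"
    using v by (auto simp: reach_def rtrancl_power)
  with N show ?thesis
  proof (induction L arbitrary: N u rule: less_induct)
    case (less L)
    note N = less.prems(1-3)
    have mN: "mmatching F N"
      using N(1) by (simp add: max_matching_def)
    show ?case
    proof (rule ccontr)
      assume "u \<noteq> v"
      with less.prems(4) obtain K where K: "L = Suc K"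
        by (cases L) auto
      then obtain x where x: "(u, x) \<in> adjacency F" "(x, v) \<in> adjacency F ^^ K"
        using less.prems(4) relpow_Suc_D2 by metis
      then obtain e where e: "e \<in> medges F" "mends F e = {u, x}"
        by (auto simp: adjacency_def)
      then have xu: "x \<noteq> u"
        using multigraphD(4) [OF F(1) e(1)] by auto
      have xN: "x \<in> covered F N"
        using max_matching_edge_covered [OF F(1) N(1) e(1)] e(2) N(2) by auto
      then have "x \<noteq> v"
        using N(3) by blast
      with x(2) obtain J where J: "K = Suc J"
        by (cases K) auto
      then obtain z where z: "(x, z) \<in> adjacency F" "(z, v) \<in> adjacency F ^^ J"
        using x(2) relpow_Suc_D2 by metis
      then obtain h where h: "h \<in> medges F" "mends F h = {x, z}"
        by (auto simp: adjacency_def)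
      obtain g where g: "g \<in> N" "x \<in> mends F g"
        using xN by (auto simp: covered_def)
      then have gF: "g \<in> medges F"
        using mN by (auto simp: mmatching_def)
      obtain y where y: "mends F g = {x, y}" "x \<noteq> y" "x \<in> mverts F"
        using multigraph_edgeE [OF F(1) gF g(2)] by blast
      have yN: "y \<in> covered F N"
        using g(1) y(1) by (auto simp: covered_def)
      have eN: "e \<notin> N"
        using N(2) e(2) by (auto simp: covered_def)
      have "card {f \<in> medges F. x \<in> mends F f} = 2"
        using F(2) y(3) by (simp add: regular_def mdegree_def)
      moreover have "e \<noteq> g"
        using eN g(1) by blast
      then have "card {e, g} = 2"
        by simp
      moreover have "{e, g} \<subseteq> {f \<in> medges F. x \<in> mends F f}"
        using e gF g(2) by simp
      ultimately have "{f \<in> medges F. x \<in> mends F f} = {e, g}"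
        by (metis card.infinite card_subset_eq zero_neq_numeral)
      \<comment> \<open>At \<open>x\<close>, of degree two, the walk either returns to
        \<open>u\<close> along \<open>e\<close> or follows the matching edge \<open>g\<close>. Both
        cases leave a walk shorter by two steps, the second one after exchanging \<open>g\<close>
        for \<open>e\<close>.\<close>
      then have "h = e \<or> h = g"
        using h by auto
      then show False
      proof
        assume "h = e"
        then have "z = u"
          using h(2) e(2) by (auto simp: doubleton_eq_iff)
        then have "u = v"
          using less.IH [of J N u] N z(2) K J by simp
        with \<open>u \<noteq> v\<close> show False ..
      next
        assume "h = g"
        then have "z = y"
          using h(2) y by (auto simp: doubleton_eq_iff)
        let ?N = "insert e (N - {g})"
        have cov: "covered F (N - {g}) = covered F N - mends F g"
          by (rule covered_diff [OF mN g(1)])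
        then have "mends F e \<inter> covered F (N - {g}) = {}"
          using e(2) N(2) g(2) by auto
        then have "mmatching F ?N"
          by (rule mmatching_insert [OF mmatching_subset [OF mN Diff_subset] e(1)])
        moreover have "card ?N = card N"
          using eN card_Suc_Diff1 [OF finite_mmatching [OF F(1) mN] g(1)] finite_mmatching [OF F(1) mN]
          by simp
        ultimately have "max_matching F ?N"
          by (rule max_matching_card_eq [OF N(1)])
        moreover have "covered F ?N = {u, x} \<union> (covered F N - {x, y})"
          using cov e(2) y(1) by (simp add: covered_def)
        then have "y \<notin> covered F ?N" "v \<notin> covered F ?N"
          using y(2) yN N(2,3) \<open>x \<noteq> v\<close> \<open>u \<noteq> v\<close> by auto
        ultimately have "y = v"
          using less.IH [of J ?N y] z(2) \<open>z = y\<close> K J by simp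
        with yN N(3) show False by simp
      qed
    qed
  qed
qed

section \<open>Two-factors, odd cycles and cut estimates\<close>

lemma ecut_compl: "multigraph G \<Longrightarrow> ecut G (mverts G - X) = ecut G X"
  by (auto simp: ecut_def multigraph_def)

text \<open>A matching edge inside \<open>X\<close> contributes 0 to the sum, a cut one at most 1 in
  absolute value; the uncovered vertices make up the last term.\<close>

lemma matching_sum_bound:
  fixes s :: "'v \<Rightarrow> int"
  assumes G: "multigraph G" and N: "mmatching G N" and X: "finite X"
    and s: "\<And>v. \<bar>s v\<bar> \<le> 1" "\<And>e. e \<in> N \<Longrightarrow> sum s (mends G e) = 0"
  shows "\<bar>sum s X\<bar> \<le> int (card (ecut G X \<inter> N)) + \<bar>sum s (X - covered G N)\<bar>"
proof -
  have finN: "finite N"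
    by (rule finite_mmatching [OF G N])
  have "\<bar>sum s (X \<inter> covered G N)\<bar> = \<bar>sum s (\<Union>e\<in>N. X \<inter> mends G e)\<bar>"
    by (simp add: covered_def)
  also have "\<dots> = \<bar>\<Sum>e\<in>N. sum s (X \<inter> mends G e)\<bar>"
  proof -
    have "(X \<inter> mends G e) \<inter> (X \<inter> mends G f) = {}" if "e \<in> N" "f \<in> N" "e \<noteq> f" for e f
      using mmatching_unique [OF N] that by blast
    then show ?thesis
      using X finN by (subst sum.UNION_disjoint) auto
  qed
  also have "\<dots> \<le> (\<Sum>e\<in>N. \<bar>sum s (X \<inter> mends G e)\<bar>)"
    by (rule sum_abs)
  also have "\<dots> \<le> (\<Sum>e\<in>N. of_bool (e \<in> ecut G X))"
  proof (rule sum_mono)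
    fix e assume e: "e \<in> N"
    then have eG: "e \<in> medges G"
      using N by (auto simp: mmatching_def)
    then obtain a b where ab: "mends G e = {a, b}" "a \<noteq> b"
      using multigraphD(4) [OF G] by (force simp: card_2_iff)
    consider "a \<in> X" "b \<in> X" | "a \<in> X" "b \<notin> X" | "a \<notin> X" "b \<in> X" | "a \<notin> X" "b \<notin> X"
      by blast
    then show "\<bar>sum s (X \<inter> mends G e)\<bar> \<le> of_bool (e \<in> ecut G X)"
      using s(2) [OF e] s(1) [of a] s(1) [of b] eG ab
      by cases (auto simp: ecut_def)
  qed
  also have "\<dots> = int (card (ecut G X \<inter> N))"
    using finN by (simp add: Int_def conj_commute)
  finally have "\<bar>sum s (X \<inter> covered G N)\<bar> \<le> int (card (ecut G X \<inter> N))" .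
  moreover have "sum s X = sum s (X \<inter> covered G N) + sum s (X - covered G N)"
    using X by (rule sum.Int_Diff)
  ultimately show ?thesis
    by linarith
qed

text \<open>Every vertex lies on three edges of \<open>G\<close> and two of \<open>F\<close>, hence
  on exactly one remaining edge.\<close>

lemma two_factor_complement:
  assumes G: "multigraph G" "cubic G" and F: "two_factor G F"
  shows "mmatching G (medges G - medges F)" "covered G (medges G - medges F) = mverts G"
proof -
  let ?M = "medges G - medges F"
  have sub: "medges F \<subseteq> medges G" "mends F = mends G" "mverts F = mverts G" "regular 2 F"
    using F by (auto simp: two_factor_def msubgraph_def)
  have one: "\<exists>g. \<forall>e. e \<in> ?M \<and> v \<in> mends G e \<longleftrightarrow> e = g" if v: "v \<in> mverts G" for v
  proof -
    have "{e \<in> ?M. v \<in> mends G e} = {e \<in> medges G. v \<in> mends G e} - {e \<in> medges F. v \<in> mends G e}"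
      by auto
    moreover have "card {e \<in> medges G. v \<in> mends G e} = 3"
      using G(2) v by (simp add: cubic_def regular_def mdegree_def)
    moreover have "card {e \<in> medges F. v \<in> mends G e} = 2"
      using sub v by (simp add: regular_def mdegree_def)
    moreover have "{e \<in> medges F. v \<in> mends G e} \<subseteq> {e \<in> medges G. v \<in> mends G e}"
      using sub(1) by auto
    ultimately have "card {e \<in> ?M. v \<in> mends G e} = 1"
      by (simp add: card_Diff_subset card_ge_0_finite)
    then show ?thesis
      by (simp add: card_1_singleton_iff set_eq_iff)
  qed
  have "e = f" if "e \<in> ?M" "f \<in> ?M" "x \<in> mends G e" "x \<in> mends G f" for e f x
  proof -
    have "x \<in> mverts G"
      using that multigraphD(3) [OF G(1)] by auto
    then obtain g where "\<forall>e. e \<in> ?M \<and> x \<in> mends G e \<longleftrightarrow> e = g"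
      using one by blast
    then show ?thesis
      using that by metis
  qed
  then show "mmatching G ?M"
    unfolding mmatching_def pairwise_def disjnt_iff by blast
  show "covered G ?M = mverts G"
  proof
    show "covered G ?M \<subseteq> mverts G"
      using multigraphD(3) [OF G(1)] by (auto simp: covered_def)
    show "mverts G \<subseteq> covered G ?M"
    proof
      fix v assume "v \<in> mverts G"
      then obtain g where "\<forall>e. e \<in> ?M \<and> v \<in> mends G e \<longleftrightarrow> e = g"
        using one by blast
      then have "g \<in> ?M" "v \<in> mends G g"
        by metis+
      then show "v \<in> covered G ?M"
        unfolding covered_def by blast
    qed
  qed
qed

lemma two_factor_delete_perfect_matching:
  assumes G: "multigraph G" "cubic G" and M: "mmatching G M" "covered G M = mverts G"
  shows "two_factor G (delete_edges G M)"
proof -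
  have "mdegree (delete_edges G M) v = 2" if v: "v \<in> mverts G" for v
  proof -
    obtain e where e: "e \<in> M" "v \<in> mends G e"
      using M(2) v by (auto simp: covered_def)
    then have "{f \<in> medges G - M. v \<in> mends G f} = {f \<in> medges G. v \<in> mends G f} - {e}"
      using mmatching_unique [OF M(1)] by blast
    moreover have "e \<in> {f \<in> medges G. v \<in> mends G f}"
      using e M(1) by (auto simp: mmatching_def)
    moreover have "card {f \<in> medges G. v \<in> mends G f} = 3"
      using G(2) v by (simp add: cubic_def regular_def mdegree_def)
    ultimately show ?thesis
      by (simp add: mdegree_def)
  qed
  then show ?thesis
    using multigraph_delete_edges [OF G(1)]
    by (auto simp: two_factor_def msubgraph_def regular_def)
qed

text \<open>The \<open>LEAST\<close> in \<open>oddness\<close> is attained once some 2-factor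
  exists; the complement of a perfect matching from \<open>petersen\<close> is one.\<close>

lemma oddness_attained:
  assumes "multigraph G" "cubic G" "bridgeless G"
  obtains F where "two_factor G F" "card {C. odd_cycle F C} = oddness G"
proof -
  obtain M where "mmatching G M" "covered G M = mverts G"
    using petersen [OF assms] .
  then have "two_factor G (delete_edges G M)"
    by (rule two_factor_delete_perfect_matching [OF assms(1,2)])
  then have "\<exists>m F. two_factor G F \<and> m = card {C. odd_cycle F C}"
    by blast
  from LeastI_ex [OF this] show thesis
    using that by (auto simp: oddness_def)
qed

lemma mcycle_component_of_mcycle:
  assumes H: "multigraph H" and C: "mcycle H C" "c \<in> mverts C"
  shows "mcycle (component_at H c) C"
proof -
  have C': "msubgraph C H" "mconnected C" "multigraph C" "mends C = mends H" "medges C \<subseteq> medges H"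
      "mverts C \<subseteq> mverts H"
    using C(1) by (auto simp: mcycle_def msubgraph_def)
  have "mverts C \<subseteq> reach H c"
    using mconnected_subset_reach [OF C'(2) C(2)] reach_mono [OF C'(1), of c] by blast
  moreover have "mends H e \<subseteq> mverts C" if "e \<in> medges C" for e
    using multigraphD(3) [OF C'(3) that] C'(4) by simp
  ultimately have "msubgraph C (component_at H c)"
    using C' by (auto simp: msubgraph_def)
  then show ?thesis
    using C(1) by (simp add: mcycle_def)
qed

text \<open>Deleting the cut leaves both cycles intact, as neither uses a cut edge, and puts them
  into different components. A cut of fewer than \<open>n\<close> edges would thus contradict the
  connectivity assumption.\<close>

lemma cyclic_cut_bound:
  assumes G: "multigraph G" and n: "cyclically_edge_connected n G"
    and C: "mcycle G C1" "mcycle G C2" and X: "mverts C1 \<subseteq> X" "mverts C2 \<inter> X = {}"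
  shows "n \<le> int (card (ecut G X))"
proof (rule ccontr)
  assume small: "\<not> n \<le> int (card (ecut G X))"
  define H where "H = delete_edges G (ecut G X)"
  have H: "multigraph H" "mverts H = mverts G" "ecut H X = {}"
    using multigraph_delete_edges [OF G] by (auto simp: H_def ecut_def)
  obtain c1 c2 where c: "c1 \<in> mverts C1" "c2 \<in> mverts C2"
    using C by (fastforce simp: mcycle_def mconnected_def)
  have cG: "c1 \<in> mverts G" "c2 \<in> mverts G"
    using C c by (auto simp: mcycle_def msubgraph_def)
  have "reach H c1 \<subseteq> X"
    using H(3) X(1) c(1) by (intro reach_closed) auto
  then have notin: "c2 \<notin> reach H c1"
    using X(2) c(2) by blast
  have cyc: "mcycle H C" if "mcycle G C" "mverts C \<subseteq> X \<or> mverts C \<inter> X = {}" for C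
  proof -
    have C: "multigraph C" "mends C = mends G" "medges C \<subseteq> medges G" "mverts C \<subseteq> mverts G"
      using that(1) by (auto simp: mcycle_def msubgraph_def)
    have "e \<notin> ecut G X" if "e \<in> medges C" for e
      using multigraphD(3) [OF C(1) that] \<open>mverts C \<subseteq> X \<or> mverts C \<inter> X = {}\<close> C(2)
      by (auto simp: ecut_def)
    then have "msubgraph C H"
      using C by (auto simp: msubgraph_def H_def)
    then show ?thesis
      using that(1) by (simp add: mcycle_def)
  qed
  have "(c1, c2) \<notin> (adjacency H)\<^sup>*"
    using notin by (simp add: reach_def)
  then have "\<not> mconnected H"
    using cG H(2) by (auto simp: mconnected_def)
  moreover have "ecut G X \<subseteq> medges G"
    by (auto simp: ecut_def)
  ultimately have "edge_cut G (ecut G X)"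
    by (simp add: edge_cut_def H_def)
  moreover have "component H (component_at H c1)" "component H (component_at H c2)"
    using cG H by (auto intro: component_component_at)
  moreover have "reach H c1 \<noteq> reach H c2"
    using notin reach_refl [of c2 H] by blast
  then have "component_at H c1 \<noteq> component_at H c2"
    by (metis induced_sel(1))
  moreover have "mcycle (component_at H c1) C1" "mcycle (component_at H c2) C2"
    using cyc C X c by (auto intro: mcycle_component_of_mcycle [OF H(1)])
  ultimately show False
    using n small unfolding cyclically_edge_connected_def H_def by force
qed

text \<open>The vertices of \<open>B\<close> lie in different components of \<open>F\<close>, and
  each such component leaves \<open>X\<close>. By parity it does so through at least two
  edges.\<close>

lemma card_ecut_missed:
  assumes F: "multigraph F" "regular 2 F" and X: "X \<subseteq> mverts F"
    and B: "B \<subseteq> X" "\<And>u v. u \<in> B \<Longrightarrow> v \<in> B \<Longrightarrow> v \<in> reach F u \<Longrightarrow> u = v"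
    and leaves: "\<And>v. v \<in> B \<Longrightarrow> \<not> reach F v \<subseteq> X"
  shows "2 * card B \<le> card (ecut F X)"
proof -
  let ?cut = "\<lambda>v. ecut F (X \<inter> reach F v)"
  have finB: "finite B"
    using B(1) X multigraphD(1) [OF F(1)] by (meson finite_subset)
  have sub: "?cut v \<subseteq> ecut F X" "e \<in> ?cut v \<Longrightarrow> mends F e \<subseteq> reach F v" for e v
    using edge_subset_reach [OF F(1), of _ v] by (auto simp: ecut_def)
  have ge2: "2 \<le> card (?cut v)" if v: "v \<in> B" for v
  proof -
    have XV: "X \<inter> reach F v \<subseteq> mverts F"
      using X by blast
    have "(\<Sum>u\<in>X \<inter> reach F v. mdegree F u) = 2 * card (X \<inter> reach F v)"
      using F(2) XV by (simp add: regular_def subset_iff)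
    with handshake [OF F(1) XV]
    have "2 * card (X \<inter> reach F v) = card (?cut v) + 2 * card {e \<in> medges F. mends F e \<subseteq> X \<inter> reach F v}"
      by simp
    then have "even (card (?cut v))"
      by presburger
    moreover have "?cut v \<noteq> {}"
    proof
      assume "?cut v = {}"
      moreover have "v \<in> X \<inter> reach F v"
        using v B(1) by auto
      ultimately have "reach F v \<subseteq> X \<inter> reach F v"
        by (rule reach_closed)
      then show False
        using leaves [OF v] by blast
    qed
    then have "card (?cut v) \<noteq> 0"
      using finite_ecut [OF F(1)] by simp
    ultimately show ?thesis
      by presburger
  qed
  have disj: "?cut v \<inter> ?cut w = {}" if vw: "v \<in> B" "w \<in> B" "v \<noteq> w" for v w
  proof (rule ccontr)
    assume "?cut v \<inter> ?cut w \<noteq> {}"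
    then obtain e where e: "e \<in> ?cut v" "e \<in> ?cut w"
      by blast
    then have "mends F e \<noteq> {}"
      by (auto simp: ecut_def)
    then have "reach F v \<inter> reach F w \<noteq> {}"
      using sub(2) [OF e(1)] sub(2) [OF e(2)] by blast
    then have "reach F v = reach F w"
      by (rule reach_disjoint)
    then show False
      using B(2) [OF vw(1,2)] vw(3) by simp
  qed
  have "2 * card B = (\<Sum>v\<in>B. 2)"
    by simp
  also have "\<dots> \<le> (\<Sum>v\<in>B. card (?cut v))"
    using ge2 by (rule sum_mono)
  also have "\<dots> = card (\<Union>v\<in>B. ?cut v)"
    using disj finite_ecut [OF F(1)] by (intro card_UN_disjoint [symmetric] finB) auto
  also have "\<dots> \<le> card (ecut F X)"
    using sub(1) by (intro card_mono finite_ecut [OF F(1)]) blast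
  finally show ?thesis .
qed

text \<open>A subgraph keeps the map \<open>mends\<close>, so it is determined by its vertex set and
  edge set.\<close>

lemma finite_odd_cycles:
  assumes "multigraph F"
  shows "finite {C. odd_cycle F C}"
proof (rule finite_subset)
  show "{C. odd_cycle F C} \<subseteq>
      (\<lambda>(W, A). \<lparr>mverts = W, medges = A, mends = mends F\<rparr>) ` (Pow (mverts F) \<times> Pow (medges F))"
  proof
    fix C assume "C \<in> {C. odd_cycle F C}"
    then have "mverts C \<subseteq> mverts F" "medges C \<subseteq> medges F" "mends C = mends F"
      by (auto simp: odd_cycle_def mcycle_def msubgraph_def)
    then show "C \<in> (\<lambda>(W, A). \<lparr>mverts = W, medges = A, mends = mends F\<rparr>) ` (Pow (mverts F) \<times> Pow (medges F))"
      by (intro image_eqI [of _ _ "(mverts C, medges C)"]) (cases C; simp)+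
  qed
qed (use assms in \<open>simp add: multigraph_def\<close>)

text \<open>The parity in \<open>odd_cycle\<close> is that of the number of edges, which in a
  2-regular graph equals the number of vertices.\<close>

lemma odd_cycle_component_at:
  assumes F: "multigraph F" "regular 2 F" and v: "v \<in> mverts F" and odd: "odd (card (reach F v))"
  shows "odd_cycle F (component_at F v)"
proof -
  let ?C = "component_at F v"
  have C: "mcycle F ?C"
    by (rule mcycle_component_at [OF F v])
  then have "multigraph ?C" "regular 2 ?C"
    by (auto simp: mcycle_def msubgraph_def)
  moreover have "ecut ?C (mverts ?C) = {}" "{e \<in> medges ?C. mends ?C e \<subseteq> mverts ?C} = medges ?C"
    by (auto simp: ecut_def)
  ultimately have "card (mverts ?C) = card (medges ?C)"
    using handshake [of ?C "mverts ?C"] by (simp add: regular_def)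
  then show ?thesis
    using C odd by (simp add: odd_cycle_def)
qed

section \<open>The balanced valuation and the resulting 5-flow\<close>

text \<open>The bound on \<open>n\<close> is doubled to stay in the integers. Odd values of
  \<open>s\<close> supply the parity needed at vertices of degree 3.\<close>

lemma balanced_valuation_exists:
  fixes G :: "('v, 'e) multigraph" and n :: int
  assumes G: "multigraph G" "cubic G" and F: "two_factor G F"
    and n: "cyclically_edge_connected n G" "5 * int (card {C. odd_cycle F C}) - 2 \<le> 2 * n"
  obtains s :: "'v \<Rightarrow> int"
  where "\<And>v. odd (s v)"
    "\<And>X. X \<subseteq> mverts G \<Longrightarrow> 5 * \<bar>sum s X\<bar> \<le> 3 * int (card (ecut G X))"
proof -
  let ?V = "mverts G"
  define M where "M = medges G - medges F"
  have M: "mmatching G M" "covered G M = ?V"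
    using two_factor_complement [OF G F] by (auto simp: M_def)
  have F': "multigraph F" "mverts F = ?V" "medges F \<subseteq> medges G" "mends F = mends G" "regular 2 F"
    using F by (auto simp: two_factor_def msubgraph_def)
  obtain N where N: "max_matching F N"
    using max_matching_exists [OF F'(1)] .
  then have mN: "mmatching F N"
    by (simp add: max_matching_def)
  have finV: "finite ?V"
    using multigraphD(1) [OF G(1)] .
  have NM: "N \<subseteq> medges G" "M \<subseteq> medges G"
    using mN F'(3) by (auto simp: mmatching_def M_def)
  have "\<exists>c :: 'v \<Rightarrow> bool. \<forall>p\<in>mends G ` M \<union> mends G ` N. \<forall>x\<in>p. \<forall>y\<in>p. x \<noteq> y \<longrightarrow> c x \<noteq> c y"
  proof (rule matchings_union_bipartite)
    show "finite (mends G ` N)"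
      using finite_mmatching [OF F'(1) mN] by simp
    show "card p = 2" if "p \<in> mends G ` M \<union> mends G ` N" for p
      using that NM multigraphD(4) [OF G(1)] by auto
    show "pairwise disjnt (mends G ` M)" "pairwise disjnt (mends G ` N)"
      using M(1) mN F'(4) by (auto simp: mmatching_def pairwise_def)
    show "\<Union>(mends G ` N) \<subseteq> \<Union>(mends G ` M)"
      using M(2) NM(1) multigraphD(3) [OF G(1)] by (fastforce simp: covered_def)
  qed
  then obtain c :: "'v \<Rightarrow> bool"
    where "\<forall>p\<in>mends G ` M \<union> mends G ` N. \<forall>x\<in>p. \<forall>y\<in>p. x \<noteq> y \<longrightarrow> c x \<noteq> c y"
    by (elim exE)
  note c = this [rule_format]
  define s :: "'v \<Rightarrow> int" where "s v = (if c v then 1 else - 1)" for v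
  have s_abs: "\<bar>s v\<bar> \<le> 1" for v
    by (simp add: s_def)
  have s_edge: "sum s (mends G e) = 0" if e: "e \<in> M \<union> N" for e
  proof -
    have "e \<in> medges G"
      using e NM by blast
    then obtain a b where ab: "mends G e = {a, b}" "a \<noteq> b"
      using multigraphD(4) [OF G(1)] by (force simp: card_2_iff)
    then have "c a \<noteq> c b"
      using e by (intro c [of "mends G e"]) auto
    then show ?thesis
      using ab by (simp add: s_def)
  qed
  define B where "B = ?V - covered F N"
  have finB: "finite B"
    using finV by (simp add: B_def)
  have single: "u = v" if "u \<in> B" "v \<in> B" "v \<in> reach F u" for u v
    using two_regular_missed_unique [OF F'(1,5) N] that by (auto simp: B_def)
  have odd_C: "odd_cycle F (component_at F v)" if v: "v \<in> B" for v
  proof (rule odd_cycle_component_at [OF F'(1,5)])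
    show vV: "v \<in> mverts F"
      using v F'(2) by (simp add: B_def)
    have "reach F v - covered F N = {v}"
      using single [OF v] v reach_subset [OF F'(1) vV] F'(2) by (auto simp: B_def)
    then show "odd (card (reach F v))"
      by (rule odd_card_reach [OF F'(1) mN vV])
  qed
  have "inj_on (component_at F) B"
  proof (rule inj_onI)
    fix u v assume uv: "u \<in> B" "v \<in> B" "component_at F u = component_at F v"
    then have "reach F u = reach F v"
      by (metis induced_sel(1))
    then show "u = v"
      using single uv by simp
  qed
  \<comment> \<open>Different missed vertices lie in different components, each an odd
    cycle.\<close>
  then have card_B: "card B \<le> card {C. odd_cycle F C}"
    using odd_C by (intro card_inj_on_le finite_odd_cycles [OF F'(1)]) auto
  have bound_M: "\<bar>sum s X\<bar> \<le> int (card (ecut G X \<inter> M))" if X: "X \<subseteq> ?V" for X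
  proof -
    have "\<bar>sum s X\<bar> \<le> int (card (ecut G X \<inter> M)) + \<bar>sum s (X - covered G M)\<bar>"
      using matching_sum_bound [of G M X s] G(1) M(1) finite_subset [OF X finV] s_abs s_edge by simp
    moreover have "X - covered G M = {}"
      using X M(2) by blast
    ultimately show ?thesis
      by (simp only: sum.empty)
  qed
  have bound_N: "\<bar>sum s X\<bar> \<le> int (card (ecut F X \<inter> N)) + \<bar>sum s (X - covered F N)\<bar>"
    if X: "X \<subseteq> ?V" for X
    using matching_sum_bound [of F N X s] F'(1,4) mN finite_subset [OF X finV] s_abs s_edge by simp
  have "ecut G ?V = {}"
    using multigraphD(3) [OF G(1)] by (auto simp: ecut_def)
  then have sV: "sum s ?V = 0"
    using bound_M [of ?V] by simp
  have sB: "sum s B = 0"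
  proof -
    have cov: "covered F N \<subseteq> ?V"
      using covered_subset [OF F'(1) mN] F'(2) by simp
    \<comment> \<open>For the set of covered vertices both terms of \<open>bound_N\<close> vanish:
      it cuts no edge of \<open>N\<close> and contains no missed vertex.\<close>
    have "ecut F (covered F N) \<inter> N = {}"
      by (auto simp: ecut_def covered_def)
    then have "sum s (covered F N) = 0"
      using bound_N [OF cov] by simp
    then show ?thesis
      using sV sum_diff [OF finV cov, of s] by (simp add: B_def)
  qed
  have abs_card: "\<bar>sum s X\<bar> \<le> int (card X)" for X
    using order_trans [OF sum_abs sum_bounded_above [OF s_abs]] by simp
  \<comment> \<open>The parts of \<open>B\<close> inside and outside \<open>X\<close> have opposite
    sums, each bounded by its own size.\<close>
  have half: "2 * \<bar>sum s (X \<inter> B)\<bar> \<le> int (card B)" for X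
  proof -
    have "sum s B = sum s (B \<inter> X) + sum s (B - X)"
      by (rule sum.Int_Diff [OF finB])
    moreover have "card B = card (B \<inter> X) + card (B - X)"
      by (rule card_Int_Diff [OF finB])
    ultimately show ?thesis
      using abs_card [of "B \<inter> X"] abs_card [of "B - X"] sB by (simp add: Int_commute)
  qed
  have diff_B: "X - covered F N = X \<inter> B" if "X \<subseteq> ?V" for X
    using that by (auto simp: B_def)
  have cut_split: "card (ecut G X) = card (ecut G X \<inter> M) + card (ecut F X)" for X
  proof -
    have "ecut G X - M = ecut F X"
      using F'(3,4) by (auto simp: ecut_def M_def)
    then show ?thesis
      using card_Int_Diff [OF finite_ecut [OF G(1)], of X M] by simp
  qed
  have bound_F: "\<bar>sum s X\<bar> \<le> int (card (ecut F X)) + \<bar>sum s (X \<inter> B)\<bar>" if X: "X \<subseteq> ?V" for X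
  proof -
    have "card (ecut F X \<inter> N) \<le> card (ecut F X)"
      by (intro card_mono finite_ecut [OF F'(1)]) auto
    then show ?thesis
      using bound_N [OF X] diff_B [OF X] by simp
  qed
  have odd_inside: "\<exists>v\<in>X \<inter> B. reach F v \<subseteq> X"
    if X: "X \<subseteq> ?V" and viol: "3 * int (card (ecut G X)) < 5 * \<bar>sum s X\<bar>" for X
  proof (rule ccontr)
    assume "\<not> ?thesis"
    then have "2 * card (X \<inter> B) \<le> card (ecut F X)"
      using X F'(2) single by (intro card_ecut_missed [OF F'(1,5)]) auto
    \<comment> \<open>Three times \<open>bound_M\<close> plus twice \<open>bound_F\<close> bounds
      \<open>5 * \<bar>sum s X\<bar>\<close> by three times the cut, because
      \<open>2 * \<bar>sum s (X \<inter> B)\<bar>\<close> is at most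
      \<open>card (ecut F X)\<close>.\<close>
    then show False
      using bound_M [OF X] bound_F [OF X] abs_card [of "X \<inter> B"] viol cut_split [of X] by linarith
  qed
  have "5 * \<bar>sum s X\<bar> \<le> 3 * int (card (ecut G X))" if X: "X \<subseteq> ?V" for X
  proof (rule ccontr)
    assume "\<not> ?thesis"
    then have viol: "3 * int (card (ecut G X)) < 5 * \<bar>sum s X\<bar>"
      by simp
    \<comment> \<open>The complement has the same cut and the opposite sum, so it violates the
      inequality too and contains an odd cycle of its own.\<close>
    have "sum s (?V - X) = - sum s X"
      using sum_diff [OF finV X, of s] sV by simp
    then have viol': "3 * int (card (ecut G (?V - X))) < 5 * \<bar>sum s (?V - X)\<bar>"
      using viol ecut_compl [OF G(1), of X] by simp
    obtain u v where uv: "u \<in> B" "reach F u \<subseteq> X" "v \<in> B" "reach F v \<subseteq> ?V - X"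
      using odd_inside [OF X viol] odd_inside [OF _ viol'] by blast
    have cyc: "mcycle G (component_at F w)" if "w \<in> B" for w
      using odd_C [OF that] F'(3) unfolding odd_cycle_def mcycle_def msubgraph_def
      by (auto simp: F'(2,4))
    have "n \<le> int (card (ecut G X))"
      using uv by (intro cyclic_cut_bound [OF G(1) n(1) cyc [OF uv(1)] cyc [OF uv(3)]]) auto
    moreover have "card B \<le> card {C. odd_cycle F C}"
      by (rule card_B)
    \<comment> \<open>\<open>bound_M\<close>, \<open>bound_F\<close> and \<open>viol\<close> give
      \<open>\<bar>sum s X\<bar> < 3 * \<bar>sum s (X \<inter> B)\<bar>\<close>; rounding this to
      the next integer is what makes the constant in the bound on \<open>n\<close>
      sufficient.\<close>
    ultimately show False
      using bound_M [OF X] bound_F [OF X] half [of X] viol cut_split [of X] n(2) by linarith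
  qed
  moreover have "odd (s v)" for v
    by (simp add: s_def)
  ultimately show thesis
    using that by blast
qed

text \<open>Under an arbitrary orientation \<open>t\<close>, \<open>h\<close> the net degree at a
  vertex of degree 3 is odd, like \<open>s\<close>. The signed flow obtained becomes a flow in the
  required sense by reversing the edges with negative value.\<close>

lemma cubic_balanced_valuation_flow:
  fixes G :: "('v, 'e) multigraph" and s :: "'v \<Rightarrow> int"
  assumes G: "multigraph G" "cubic G" and odd: "\<And>v. odd (s v)"
    and bal: "\<And>X. X \<subseteq> mverts G \<Longrightarrow> 5 * \<bar>sum s X\<bar> \<le> 3 * int (card (ecut G X))"
  shows "\<exists>D \<phi>. nowhere_zero_k_flow 5 G D \<phi>"
proof -
  let ?V = "mverts G" and ?E = "medges G"
  have fin: "finite ?V" "finite ?E"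
    using multigraphD(1,2) [OF G(1)] .
  have "\<forall>e\<in>?E. \<exists>a b. mends G e = {a, b} \<and> a \<noteq> b"
    using multigraphD(4) [OF G(1)] by (auto simp: card_2_iff)
  then obtain t h where th: "\<And>e. e \<in> ?E \<Longrightarrow> mends G e = {t e, h e}" "\<And>e. e \<in> ?E \<Longrightarrow> t e \<noteq> h e"
    by metis
  have thV: "t e \<in> ?V" "h e \<in> ?V" if "e \<in> ?E" for e
    using multigraphD(3) [OF G(1) that] th(1) [OF that] by auto
  have "even (s v + net ?E t h (\<lambda>_. 1) v)" if v: "v \<in> ?V" for v
  proof -
    \<comment> \<open>The net degree is the degree minus twice the number of incoming edges.\<close>
    have "net ?E t h (\<lambda>_. 1) v = (\<Sum>e\<in>?E. of_bool (v \<in> mends G e) - 2 * of_bool (h e = v))"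
      unfolding net_def using th by (intro sum.cong) auto
    also have "\<dots> = int (mdegree G v) - 2 * (\<Sum>e\<in>?E. of_bool (h e = v))"
      using fin by (simp add: sum_subtractf sum_distrib_left mdegree_def Int_def)
    finally show ?thesis
      using G(2) v odd [of v] by (simp add: cubic_def regular_def)
  qed
  moreover have "cap_out ?E t h (\<lambda>_. 1) X + cap_out ?E h t (\<lambda>_. 1) X = int (card (ecut G X))" for X
  proof -
    have "cap_out ?E t h (\<lambda>_. 1) X + cap_out ?E h t (\<lambda>_. 1) X = (\<Sum>e\<in>?E. of_bool (e \<in> ecut G X))"
      unfolding cap_out_def sum.distrib [symmetric] using th by (intro sum.cong) (auto simp: ecut_def)
    moreover have "?E \<inter> {e. e \<in> ecut G X} = ecut G X"
      by (auto simp: ecut_def)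
    ultimately show ?thesis
      using fin by simp
  qed
  ultimately have "\<exists>\<psi>. (\<forall>e\<in>?E. \<psi> e \<noteq> 0 \<and> \<bar>\<psi> e\<bar> \<le> 4) \<and> (\<forall>v\<in>?V. net ?E t h \<psi> v = 0)"
    using fin thV bal by (intro balanced_valuation_flow [where s = s]) auto
  then obtain \<psi> where \<psi>: "\<forall>e\<in>?E. \<psi> e \<noteq> 0 \<and> \<bar>\<psi> e\<bar> \<le> 4" "\<forall>v\<in>?V. net ?E t h \<psi> v = 0"
    by (elim exE conjE)
  define D where "D = \<lparr>verts = ?V, arcs = ?E,
    tail = (\<lambda>e. if 0 < \<psi> e then t e else h e), head = (\<lambda>e. if 0 < \<psi> e then h e else t e)\<rparr>"
  define \<phi> where "\<phi> e = nat \<bar>\<psi> e\<bar>" for e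
  have "orientation G D"
    using th(1) by (auto simp: orientation_def D_def)
  moreover have "\<phi> e \<in> {0..5 - 1}" "\<phi> e \<noteq> 0" if "e \<in> ?E" for e
    using \<psi>(1) that by (force simp: \<phi>_def)+
  moreover have "(\<Sum>e\<in>out_arcs D v. \<phi> e) = (\<Sum>e\<in>in_arcs D v. \<phi> e)" if v: "v \<in> ?V" for v
  proof -
    have "int (\<Sum>e\<in>out_arcs D v. \<phi> e) - int (\<Sum>e\<in>in_arcs D v. \<phi> e)
      = (\<Sum>e\<in>?E. if tail D e = v then int (\<phi> e) else 0) - (\<Sum>e\<in>?E. if head D e = v then int (\<phi> e) else 0)"
      using fin by (simp add: out_arcs_def in_arcs_def D_def sum.inter_filter if_distrib [of int] cong: if_cong)
    also have "\<dots> = net ?E t h \<psi> v"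
      unfolding net_def sum_subtractf [symmetric] by (intro sum.cong) (auto simp: D_def \<phi>_def)
    finally show ?thesis
      using \<psi>(2) v by (simp del: of_nat_sum)
  qed
  ultimately have "nowhere_zero_k_flow 5 G D \<phi>"
    by (simp add: nowhere_zero_k_flow_def k_flow_def)
  then show ?thesis
    by blast
qed

theorem theorem1:
  fixes G :: "('v, 'e) multigraph" and n :: int
  assumes "multigraph G"
    and "cubic G"
    and "bridgeless G"
    and "cyclically_edge_connected n G"
    and "real_of_int n \<ge> 5 / 2 * real (oddness G) - 1"
  shows "\<exists>D \<phi>. nowhere_zero_k_flow 5 G D \<phi>"
proof -
  obtain F where F: "two_factor G F" "card {C. odd_cycle F C} = oddness G"
    using oddness_attained [OF assms(1-3)] .
  \<comment> \<open>Doubling clears the fraction, so the bound can be read in the integers.\<close>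
  have "real_of_int (5 * int (oddness G) - 2) \<le> real_of_int (2 * n)"
    using assms(5) by simp
  then have "5 * int (card {C. odd_cycle F C}) - 2 \<le> 2 * n"
    unfolding F(2) of_int_le_iff .
  then obtain s :: "'v \<Rightarrow> int" where "\<And>v. odd (s v)"
    "\<And>X. X \<subseteq> mverts G \<Longrightarrow> 5 * \<bar>sum s X\<bar> \<le> 3 * int (card (ecut G X))"
    using balanced_valuation_exists [OF assms(1,2) F(1) assms(4)] by blast
  then show ?thesis
    by (rule cubic_balanced_valuation_flow [OF assms(1,2)])
qed

end
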